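(* Suppose that $A_1,\ldots,A_r\in\mathbb{R}_+^{n\times n}$ pairwise commute in max algebra and that, for each $i\in\{1,\ldots,r\}$, all classes of $A_i$ have distinct Perron roots. Then: (i) All classes of $A_1,\ldots,A_r$ and of $A_1\oplus\cdots\oplus A_r$ coincide. (ii) The transitive closures of the reduced digraphs of $A_1,\ldots,A_r$ and of $A_1\oplus\cdots\oplus A_r$ coincide. (iii) The spectral classes of the reduced digraphs of $A_1,\ldots,A_r$ and of $A_1\oplus\cdots\oplus A_r$ coincide. In particular, $A_1,\ldots,A_r$ have the same number of distinct eigenvalues. (iv) Let $\mu_1,\ldots,\mu_m$ be the common spectral classes of $A_1,\ldots,A_r$ and denote the Perron root of the $\mu_j$-th class of $A_i$ by $\alpha_i^j$. Then, for any max polynomial $p(x_1,\ldots,x_r)$, the eigenvalues of $p(A_1,\ldots,A_r)$ are precisely $p(\alpha_1^j,\ldots,\alpha_r^j)$ for $j=1,\ldots,m$ (possibly with repetitions).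
   Context: Max algebra is the semiring $(\mathbb{R}_+,\oplus,\times)$, where $\mathbb{R}_+=[0,\infty)$, $a\oplus b=\max(a,b)$ and $\times$ is ordinary multiplication. All matrix operations are over this semiring: $(A\oplus B)_{ij}=\max(a_{ij},b_{ij})$, $(AB)_{ij}=\max_k a_{ik}b_{kj}$, $(Av)_i=\max_k a_{ik}v_k$. An eigenvalue of $A$ is an $\alpha\in\mathbb{R}_+$ for which there is a nonzero $v\in\mathbb{R}_+^n$ with $Av=\alpha v$. A max polynomial is obtained from a real polynomial with nonnegative coefficients by replacing the usual sum by the maximum; $p(A_1,\ldots,A_r)$ is obtained by substituting $A_i$ for $x_i$, with max-algebraic matrix operations and a constant term $c$ read as $cI$. The associated digraph of $A\in\mathbb{R}_+^{n\times n}$ has node set $N=\{1,\ldots,n\}$ and an edge $(i,j)$ whenever $a_{ij}>0$. Its strongly connected components (or their node sets $N^1,\ldots,N^t$) are called the classes of $A$ (a single node lying on no cycle also forms a class). The reduced digraph of $A$ has the classes as nodes and an edge $(\mu,\nu)$ whenever there are $i\in N^\mu$, $j\in N^\nu$ with $a_{ij}>0$. Write $\mu\to\nu$ if $\mu=\nu$ or there is a path from $\mu$ to $\nu$ in the reduced digraph. The transitive closure of the reduced digraph is the digraph on the classes with edge $(\mu,\nu)$ iff $\mu\to\nu$. The Perron root $\alpha_\mu$ of a class $\mu$ is the maximal cycle geometric mean of the submatrix $A_{\mu\mu}$ of $A$ with rows and columns in $N^\mu$, i.e. the maximum of $(a_{i_1i_2}\cdots a_{i_ki_1})^{1/k}$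 over $k\ge1$ and $i_1,\ldots,i_k\in N^\mu$. A class $\nu$ is initial if $\mu\to\nu$ implies $\mu=\nu$. A class $\nu$ is spectral if $\nu$ is initial, or if $\alpha_\nu>0$ and $\mu\to\nu$ implies $\alpha_\mu\le\alpha_\nu$. *)

theory Defs
  imports
    "HOL-Analysis.Analysis"
    "HOL-Library.Poly_Mapping"
    "Graph_Theory.Graph_Theory"
begin

text \<open>
  Matrices over the max-algebraic semiring of nonnegative reals are represented by real
  matrices, indexed by a finite type, with the entries required to be nonnegative wherever
  a matrix is introduced.
\<close>

definition nonneg_mat :: "real^'n^'m \<Rightarrow> bool" where
  "nonneg_mat A \<longleftrightarrow> (\<forall>i j. 0 \<le> A $ i $ j)"

definition nonneg_vec :: "real^'n \<Rightarrow> bool" where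
  "nonneg_vec v \<longleftrightarrow> (\<forall>i. 0 \<le> v $ i)"

text \<open>
  The number 0 is the neutral element of max on the nonnegative reals; inserting it makes the
  empty sum 0 and does not affect sums of nonnegative terms.
\<close>

definition max_sum :: "('i \<Rightarrow> real) \<Rightarrow> 'i set \<Rightarrow> real" where
  "max_sum f I = Max (insert 0 (f ` I))"

definition max_mult :: "real^'n^'n \<Rightarrow> real^'n^'n \<Rightarrow> real^'n^'n" (infixl \<open>\<otimes>\<^sub>m\<close> 70) where
  "A \<otimes>\<^sub>m B = (\<chi> i j. max_sum (\<lambda>k. A $ i $ k * B $ k $ j) UNIV)"

definition max_mult_vec :: "real^'n^'n \<Rightarrow> real^'n \<Rightarrow> real^'n" (infixl \<open>\<otimes>\<^sub>v\<close> 70) where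
  "A \<otimes>\<^sub>v v = (\<chi> i. max_sum (\<lambda>k. A $ i $ k * v $ k) UNIV)"

definition max_sum_mat :: "('i \<Rightarrow> real^'n^'n) \<Rightarrow> 'i set \<Rightarrow> real^'n^'n" where
  "max_sum_mat A I = (\<chi> i j. max_sum (\<lambda>l. A l $ i $ j) I)"

primrec max_power :: "real^'n^'n \<Rightarrow> nat \<Rightarrow> real^'n^'n" where
  "max_power A 0 = mat 1"
| "max_power A (Suc k) = A \<otimes>\<^sub>m max_power A k"

definition max_eigenvalues :: "real^'n^'n \<Rightarrow> real set" where
  "max_eigenvalues A =
     {\<alpha>. 0 \<le> \<alpha> \<and> (\<exists>v. nonneg_vec v \<and> v \<noteq> 0 \<and> A \<otimes>\<^sub>v v = \<alpha> *\<^sub>R v)}"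

text \<open>
  A max polynomial in the variables $x_1, \ldots, x_r$ is given by the real polynomial with
  nonnegative coefficients from which it arises: a finitely supported map from monomials to
  coefficients, a monomial being a finitely supported map from the indices of the variables to
  the exponents. Only the evaluation is max-algebraic.
\<close>

type_synonym max_poly = "(nat \<Rightarrow>\<^sub>0 nat) \<Rightarrow>\<^sub>0 real"

definition is_max_poly :: "nat \<Rightarrow> max_poly \<Rightarrow> bool" where
  "is_max_poly r p \<longleftrightarrow>
     (\<forall>m. 0 \<le> Poly_Mapping.lookup p m) \<and>
     (\<forall>m \<in> Poly_Mapping.keys p. Poly_Mapping.keys m \<subseteq> {1..r})"

definition max_poly_eval :: "nat \<Rightarrow> max_poly \<Rightarrow> (nat \<Rightarrow> real) \<Rightarrow> real" where
  "max_poly_eval r p x =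
     max_sum (\<lambda>m. Poly_Mapping.lookup p m * (\<Prod>i = 1..r. x i ^ Poly_Mapping.lookup m i))
       (Poly_Mapping.keys p)"

definition max_monomial_mat :: "nat \<Rightarrow> (nat \<Rightarrow>\<^sub>0 nat) \<Rightarrow> (nat \<Rightarrow> real^'n^'n) \<Rightarrow> real^'n^'n" where
  "max_monomial_mat r m A =
     foldr (\<lambda>i B. max_power (A i) (Poly_Mapping.lookup m i) \<otimes>\<^sub>m B) [1..<Suc r] (mat 1)"

definition max_poly_mat :: "nat \<Rightarrow> max_poly \<Rightarrow> (nat \<Rightarrow> real^'n^'n) \<Rightarrow> real^'n^'n" where
  "max_poly_mat r p A =
     max_sum_mat (\<lambda>m. Poly_Mapping.lookup p m *\<^sub>R max_monomial_mat r m A) (Poly_Mapping.keys p)"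

definition assoc_digraph :: "real^'n^'n \<Rightarrow> 'n pair_pre_digraph" where
  "assoc_digraph A = \<lparr> pverts = UNIV, parcs = {(i, j). A $ i $ j > 0} \<rparr>"

definition classes :: "real^'n^'n \<Rightarrow> 'n set set" where
  "classes A = verts ` pre_digraph.sccs (with_proj (assoc_digraph A))"

definition reduced_digraph :: "real^'n^'n \<Rightarrow> 'n set pair_pre_digraph" where
  "reduced_digraph A =
     \<lparr> pverts = classes A,
       parcs = {(\<mu>, \<nu>). \<mu> \<in> classes A \<and> \<nu> \<in> classes A \<and> (\<exists>i \<in> \<mu>. \<exists>j \<in> \<nu>. A $ i $ j > 0)} \<rparr>"

definition class_access :: "real^'n^'n \<Rightarrow> 'n set \<Rightarrow> 'n set \<Rightarrow> bool" where
  "class_access A \<mu> \<nu> \<longleftrightarrow> \<mu> \<rightarrow>\<^sup>*\<^bsub>with_proj (reduced_digraph A)\<^esub> \<nu>"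

definition transitive_closure_reduced_digraph :: "real^'n^'n \<Rightarrow> 'n set pair_pre_digraph" where
  "transitive_closure_reduced_digraph A =
     \<lparr> pverts = classes A, parcs = {(\<mu>, \<nu>). class_access A \<mu> \<nu>} \<rparr>"

text \<open>
  A list $i_1, \ldots, i_k$ stands for the closed walk $i_1, \ldots, i_k, i_1$; a list that does
  not describe a walk of the digraph has a zero factor and contributes mean 0.
\<close>

definition cycle_gmean :: "real^'n^'n \<Rightarrow> 'n list \<Rightarrow> real" where
  "cycle_gmean A c =
     root (length c) (\<Prod>t < length c. A $ (c ! t) $ (c ! (Suc t mod length c)))"

text \<open>
  Closed walks of unbounded length are admitted, hence the supremum. For a nonnegative matrix
  and a nonempty set of indices it is a maximum, attained by an elementary cycle.
\<close>

definition perron_root :: "real^'n^'n \<Rightarrow> 'n set \<Rightarrow> real" where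
  "perron_root A \<mu> = Sup (cycle_gmean A ` {c. c \<noteq> [] \<and> set c \<subseteq> \<mu>})"

definition initial_class :: "real^'n^'n \<Rightarrow> 'n set \<Rightarrow> bool" where
  "initial_class A \<nu> \<longleftrightarrow>
     \<nu> \<in> classes A \<and> (\<forall>\<mu> \<in> classes A. class_access A \<mu> \<nu> \<longrightarrow> \<mu> = \<nu>)"

definition spectral_classes :: "real^'n^'n \<Rightarrow> 'n set set" where
  "spectral_classes A =
     {\<nu> \<in> classes A. initial_class A \<nu> \<or>
        (perron_root A \<nu> > 0 \<and>
         (\<forall>\<mu> \<in> classes A. class_access A \<mu> \<nu> \<longrightarrow> perron_root A \<mu> \<le> perron_root A \<nu>))}"

end

theory Submission
  imports Defs
begin

text \<open>
  Everything is compared through accessibility: the preorder R given by the paths of the digraph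
  of a matrix determines the classes and the reduced digraph up to transitive closure.

  Commuting matrices have the same accessibility. Let A have distinct Perron roots and commute
  with B, and let v be an eigenvector of A supported on an initial class. Then B v, if it is not
  zero, is an eigenvector of A for the same root. A final class of its support has this root as
  its Perron root, so by distinctness it is the chosen initial class, and nothing else accesses
  it. Thus no edge of B leads into the class from outside. Iterating this outside of sets that
  are closed under predecessors shows that every edge of B is a path of A
  (\<open>commuting_reach\<close>).

  On each common class the diagonal blocks commute and are irreducible, so they have a common
  positive eigenvector. Gluing these gives a positive vector x that restricts to an eigenvector
  of every block of every matrix (\<open>commuting_adapted\<close>). A matrix is called adapted if its
  edges respect R and x is an eigenvector of its diagonal blocks; the eigenvalues are then the
  Perron roots of the blocks. Maxima, products and nonnegative multiples of adapted matrices are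
  adapted, and their roots are combined accordingly. Hence the roots of p(A) on a class are
  obtained by evaluating p at the roots of the matrices.

  Let M be adapted, and let the root of a class be positive and exceed the roots of all other
  classes that access it. Then x on this class extends uniquely to an eigenvector of M supported
  on the indices with access to the class
  (\<open>dominant_class_eigenvector\<close>, \<open>eigenvector_dominated\<close>). By
  uniqueness it is an eigenvector of every commuting adapted matrix
  (\<open>commuting_dominant_eigenvector\<close>), and its support forces the class to be spectral for
  each of the given matrices (\<open>dominant_class_spectral\<close>). This shows that the spectral classes
  agree. It also shows that the eigenvalues of a commuting adapted matrix are exactly its roots
  on the spectral classes (\<open>eigenvalues_eq_spectral_roots\<close>): in the support of an eigenvector
  with maximal support, a class whose root is the eigenvalue, and which no other such class
  accesses, is dominant in the above sense, or initial if the eigenvalue is zero.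
\<close>

section \<open>Finite maxima and max-algebraic products\<close>

lemma max_sum_upper: "finite I \<Longrightarrow> i \<in> I \<Longrightarrow> f i \<le> max_sum f I"
  unfolding max_sum_def by (intro Max_ge) auto

lemma max_sum_nonneg: "finite I \<Longrightarrow> 0 \<le> max_sum f I"
  unfolding max_sum_def by (intro Max_ge) auto

lemma max_sum_le_iff: "finite I \<Longrightarrow> 0 \<le> c \<Longrightarrow> max_sum f I \<le> c \<longleftrightarrow> (\<forall>i\<in>I. f i \<le> c)"
  unfolding max_sum_def by (subst Max_le_iff) auto

lemma max_sum_attained_pos:
  assumes "finite I" "0 < max_sum f I"
  obtains i where "i \<in> I" "max_sum f I = f i"
proof -
  have "max_sum f I \<in> insert 0 (f ` I)"
    unfolding max_sum_def using assms(1) by (intro Max_in) auto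
  then show ?thesis using assms(2) that by auto
qed

lemma max_sum_eqI:
  assumes "finite I" "\<And>i. i \<in> I \<Longrightarrow> f i \<le> c" "i \<in> I" "f i = c" "0 \<le> c"
  shows "max_sum f I = c"
  using assms max_sum_le_iff[of I c f] max_sum_upper[of I i f] by force

lemma max_sum_cong: "(\<And>i. i \<in> I \<Longrightarrow> f i = g i) \<Longrightarrow> max_sum f I = max_sum g I"
  unfolding max_sum_def by (metis image_cong)

lemma max_sum_mono:
  assumes "finite I" "\<And>i. i \<in> I \<Longrightarrow> f i \<le> g i"
  shows "max_sum f I \<le> max_sum g I"
  using assms max_sum_le_iff[of I "max_sum g I" f] max_sum_upper[of I _ g]
    max_sum_nonneg[of I g] by (meson order_trans)

lemma max_sum_mult_left:
  assumes "finite I" "0 \<le> c"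
  shows "c * max_sum f I = max_sum (\<lambda>i. c * f i) I"
proof (rule antisym)
  show "max_sum (\<lambda>i. c * f i) I \<le> c * max_sum f I"
    using assms by (subst max_sum_le_iff) (auto simp: max_sum_nonneg max_sum_upper mult_left_mono)
  show "c * max_sum f I \<le> max_sum (\<lambda>i. c * f i) I"
  proof (cases "0 < max_sum f I")
    case True
    then obtain i where "i \<in> I" "max_sum f I = f i" using max_sum_attained_pos assms(1) by blast
    then show ?thesis using max_sum_upper[OF assms(1), of i "\<lambda>i. c * f i"] by simp
  next
    case False
    then have "max_sum f I = 0" using max_sum_nonneg[OF assms(1), of f] by linarith
    then show ?thesis using max_sum_nonneg[OF assms(1)] by simp
  qed
qed

lemma max_sum_mult_right:
  assumes "finite I" "0 \<le> c"
  shows "max_sum f I * c = max_sum (\<lambda>i. f i * c) I"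
  using max_sum_mult_left[OF assms, of f] by (simp add: mult.commute)

lemma max_sum_swap:
  assumes "finite I" "finite J"
  shows "max_sum (\<lambda>i. max_sum (f i) J) I = max_sum (\<lambda>j. max_sum (\<lambda>i. f i j) I) J"
proof -
  have le: "max_sum (\<lambda>i. max_sum (f i) J) I \<le> max_sum (\<lambda>j. max_sum (\<lambda>i. f i j) I) J"
    if I: "finite I" and J: "finite J" for I :: "'c set" and J :: "'d set" and f
  proof -
    have "f i j \<le> max_sum (\<lambda>j. max_sum (\<lambda>i. f i j) I) J" if "i \<in> I" "j \<in> J" for i j
      using max_sum_upper[OF I that(1), of "\<lambda>i. f i j"]
        max_sum_upper[OF J that(2), of "\<lambda>j. max_sum (\<lambda>i. f i j) I"] by linarith
    then show ?thesis by (simp add: max_sum_le_iff max_sum_nonneg I J)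
  qed
  show ?thesis using le[OF assms, of f] le[OF assms(2,1), of "\<lambda>j i. f i j"] by linarith
qed

lemma continuous_on_max_sum:
  fixes f :: "'i \<Rightarrow> 'a::topological_space \<Rightarrow> real"
  assumes "finite I" "\<And>i. i \<in> I \<Longrightarrow> continuous_on S (f i)"
  shows "continuous_on S (\<lambda>v. max_sum (\<lambda>i. f i v) I)"
  using assms
proof (induction I rule: finite_induct)
  case empty
  then show ?case by (simp add: max_sum_def)
next
  case (insert i I)
  have "max_sum (\<lambda>i. f i v) (insert i I) = max (f i v) (max_sum (\<lambda>i. f i v) I)" for v
  proof -
    have "insert 0 ((\<lambda>i. f i v) ` insert i I) = insert (f i v) (insert 0 ((\<lambda>i. f i v) ` I))"
      by auto
    then show ?thesis unfolding max_sum_def using insert.hyps(1) by simp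
  qed
  then show ?case using insert by (auto intro!: continuous_on_max)
qed

lemma nonneg_matD: "nonneg_mat M \<Longrightarrow> 0 \<le> M $ i $ j"
  by (simp add: nonneg_mat_def)

lemma nonneg_vecD: "nonneg_vec v \<Longrightarrow> 0 \<le> v $ i"
  by (simp add: nonneg_vec_def)

lemma max_mult_vec_nth: "(M \<otimes>\<^sub>v v) $ i = max_sum (\<lambda>k. M $ i $ k * v $ k) UNIV"
  by (simp add: max_mult_vec_def)

lemma max_mult_nth: "(M \<otimes>\<^sub>m N) $ i $ j = max_sum (\<lambda>k. M $ i $ k * N $ k $ j) UNIV"
  by (simp add: max_mult_def)

lemma nonneg_max_mult_vec: "nonneg_vec (M \<otimes>\<^sub>v v)"
  by (simp add: nonneg_vec_def max_mult_vec_nth max_sum_nonneg)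

lemma nonneg_max_mult: "nonneg_mat (M \<otimes>\<^sub>m N)"
  by (simp add: nonneg_mat_def max_mult_nth max_sum_nonneg)

lemma max_mult_vec_upper: "M $ i $ k * v $ k \<le> (M \<otimes>\<^sub>v v) $ i"
  unfolding max_mult_vec_nth by (rule max_sum_upper) auto

lemma max_mult_vec_le_iff:
  "0 \<le> c \<Longrightarrow> (M \<otimes>\<^sub>v v) $ i \<le> c \<longleftrightarrow> (\<forall>k. M $ i $ k * v $ k \<le> c)"
  unfolding max_mult_vec_nth by (subst max_sum_le_iff) auto

lemma max_mult_vec_attained_pos:
  assumes "0 < (M \<otimes>\<^sub>v v) $ i"
  obtains k where "(M \<otimes>\<^sub>v v) $ i = M $ i $ k * v $ k"
  using assms that unfolding max_mult_vec_nth by (elim max_sum_attained_pos[rotated]) auto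

lemma max_mult_vec_mono:
  assumes "nonneg_mat M" "\<And>k. u $ k \<le> v $ k"
  shows "(M \<otimes>\<^sub>v u) $ i \<le> (M \<otimes>\<^sub>v v) $ i"
  unfolding max_mult_vec_nth
  by (rule max_sum_mono) (auto intro: mult_left_mono nonneg_matD assms)

lemma max_mult_vec_scaleR:
  assumes "0 \<le> c"
  shows "M \<otimes>\<^sub>v (c *\<^sub>R v) = c *\<^sub>R (M \<otimes>\<^sub>v v)"
  by (simp add: vec_eq_iff max_mult_vec_nth max_sum_mult_left[OF _ assms] mult.left_commute)

lemma max_mult_vec_assoc:
  assumes "nonneg_mat M" "nonneg_vec v"
  shows "(M \<otimes>\<^sub>m N) \<otimes>\<^sub>v v = M \<otimes>\<^sub>v (N \<otimes>\<^sub>v v)"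
proof -
  have "(M \<otimes>\<^sub>m N \<otimes>\<^sub>v v) $ i = (M \<otimes>\<^sub>v (N \<otimes>\<^sub>v v)) $ i" for i
    unfolding max_mult_vec_nth max_mult_nth
    using max_sum_swap[of UNIV UNIV "\<lambda>k l. M $ i $ l * (N $ l $ k * v $ k)"]
    by (simp add: max_sum_mult_left max_sum_mult_right nonneg_matD nonneg_vecD assms mult.assoc)
  then show ?thesis by (simp add: vec_eq_iff)
qed

lemma max_mult_assoc:
  assumes "nonneg_mat M" "nonneg_mat P"
  shows "(M \<otimes>\<^sub>m N) \<otimes>\<^sub>m P = M \<otimes>\<^sub>m (N \<otimes>\<^sub>m P)"
proof -
  have "(M \<otimes>\<^sub>m N \<otimes>\<^sub>m P) $ i $ j = (M \<otimes>\<^sub>m (N \<otimes>\<^sub>m P)) $ i $ j" for i j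
    unfolding max_mult_nth
    using max_sum_swap[of UNIV UNIV "\<lambda>k l. M $ i $ l * (N $ l $ k * P $ k $ j)"]
    by (simp add: max_sum_mult_left max_sum_mult_right nonneg_matD assms mult.assoc)
  then show ?thesis by (simp add: vec_eq_iff)
qed

lemma max_mult_vec_commute:
  assumes "M \<otimes>\<^sub>m N = N \<otimes>\<^sub>m M" "nonneg_mat M" "nonneg_mat N" "nonneg_vec v"
  shows "M \<otimes>\<^sub>v (N \<otimes>\<^sub>v v) = N \<otimes>\<^sub>v (M \<otimes>\<^sub>v v)"
  using assms by (simp flip: max_mult_vec_assoc)

definition vec_max :: "real^'n \<Rightarrow> real^'n \<Rightarrow> real^'n" where
  "vec_max u v = (\<chi> i. max (u $ i) (v $ i))"

lemma max_mult_vec_max: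
  assumes "nonneg_mat M"
  shows "M \<otimes>\<^sub>v (vec_max u v) = vec_max (M \<otimes>\<^sub>v u) (M \<otimes>\<^sub>v v)"
proof -
  have "(M \<otimes>\<^sub>v (vec_max u v)) $ i = max ((M \<otimes>\<^sub>v u) $ i) ((M \<otimes>\<^sub>v v) $ i)" for i
  proof (rule antisym)
    show "(M \<otimes>\<^sub>v (vec_max u v)) $ i \<le> max ((M \<otimes>\<^sub>v u) $ i) ((M \<otimes>\<^sub>v v) $ i)"
    proof (subst max_mult_vec_le_iff; (intro allI)?)
      show "0 \<le> max ((M \<otimes>\<^sub>v u) $ i) ((M \<otimes>\<^sub>v v) $ i)"
        using nonneg_vecD[OF nonneg_max_mult_vec, of M u i] by linarith
      fix k
      show "M $ i $ k * vec_max u v $ k \<le> max ((M \<otimes>\<^sub>v u) $ i) ((M \<otimes>\<^sub>v v) $ i)"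
        using max_mult_vec_upper[of M i k u] max_mult_vec_upper[of M i k v]
        by (auto simp: vec_max_def max_def)
    qed
    show "max ((M \<otimes>\<^sub>v u) $ i) ((M \<otimes>\<^sub>v v) $ i) \<le> (M \<otimes>\<^sub>v (vec_max u v)) $ i"
      using assms by (auto intro!: max_mult_vec_mono simp: vec_max_def)
  qed
  then show ?thesis by (simp add: vec_eq_iff vec_max_def)
qed

lemma continuous_on_max_mult_vec: "continuous_on S (\<lambda>v. M \<otimes>\<^sub>v v)"
  unfolding max_mult_vec_def
  by (intro continuous_on_vec_lambda continuous_on_max_sum continuous_intros) auto

text \<open>
  This replaces the passage to a limit of a decreasing sequence of iterates: an element with
  minimal coordinate sum among those that T does not increase cannot be decreased by T.
\<close>

lemma compact_monotone_fixpoint: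
  fixes T :: "real^'n \<Rightarrow> real^'n"
  assumes X: "compact X" and T: "continuous_on X T" "\<And>u. u \<in> X \<Longrightarrow> T u \<in> X"
    and mono: "\<And>u v. u \<in> X \<Longrightarrow> v \<in> X \<Longrightarrow> (\<And>i. u $ i \<le> v $ i) \<Longrightarrow> (\<And>i. T u $ i \<le> T v $ i)"
    and u0: "u0 \<in> X" "\<And>i. T u0 $ i \<le> u0 $ i"
  obtains u where "u \<in> X" "T u = u"
proof -
  define Y where "Y = {u \<in> X. \<forall>i. T u $ i \<le> u $ i}"
  have "closed X" using X by (rule compact_imp_closed)
  have eq: "Y = X \<inter> (\<Inter>i. {u \<in> X. T u $ i - u $ i \<le> 0})"
    by (auto simp: Y_def)
  have "closed {u \<in> X. T u $ i - u $ i \<le> 0}" for i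
  proof -
    have "continuous_on X (\<lambda>u. T u $ i - u $ i)" by (intro continuous_intros T)
    from continuous_closed_preimage[OF this \<open>closed X\<close> closed_atMost[of 0]]
    show ?thesis by (simp add: vimage_def Int_def)
  qed
  then have "compact Y" unfolding eq by (intro compact_Int_closed X closed_INT) auto
  moreover have "Y \<noteq> {}" using u0 by (auto simp: Y_def)
  moreover have "continuous_on Y (\<lambda>u. \<Sum>i\<in>UNIV. u $ i)" by (intro continuous_intros)
  ultimately obtain u where u: "u \<in> Y" "\<And>v. v \<in> Y \<Longrightarrow> (\<Sum>i\<in>UNIV. u $ i) \<le> (\<Sum>i\<in>UNIV. v $ i)"
    using continuous_attains_inf[of Y "\<lambda>u. \<Sum>i\<in>UNIV. u $ i"] by blast
  have uX: "u \<in> X" and le: "\<And>i. T u $ i \<le> u $ i" using u(1) by (auto simp: Y_def)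
  have "T u \<in> Y" using T(2)[OF uX] mono[OF T(2)[OF uX] uX le] by (auto simp: Y_def)
  from u(2)[OF this] have s: "(\<Sum>i\<in>UNIV. u $ i) \<le> (\<Sum>i\<in>UNIV. T u $ i)" .
  have "T u $ i = u $ i" for i
  proof (rule ccontr)
    assume "T u $ i \<noteq> u $ i"
    with le[of i] have "T u $ i < u $ i" by simp
    then have "(\<Sum>i\<in>UNIV. T u $ i) < (\<Sum>i\<in>UNIV. u $ i)"
      by (intro sum_strict_mono_ex1) (auto simp: le)
    with s show False by simp
  qed
  then show ?thesis using uX that by (simp add: vec_eq_iff)
qed

section \<open>Access and classes\<close>

definition reach :: "real^'n^'n \<Rightarrow> 'n \<Rightarrow> 'n \<Rightarrow> bool" where
  "reach M = (\<lambda>i j. 0 < M $ i $ j)\<^sup>*\<^sup>*"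

definition cls :: "('n \<Rightarrow> 'n \<Rightarrow> bool) \<Rightarrow> 'n \<Rightarrow> 'n set" where
  "cls R i = {j. R i j \<and> R j i}"

lemma reach_refl: "reach M i i"
  by (simp add: reach_def)

lemma reach_trans: "reach M i j \<Longrightarrow> reach M j k \<Longrightarrow> reach M i k"
  unfolding reach_def by (rule rtranclp_trans)

lemma reach_edge: "0 < M $ i $ j \<Longrightarrow> reach M i j"
  unfolding reach_def by (rule r_into_rtranclp)

lemma reach_induct_backwards [consumes 1, case_names base edge]:
  assumes "reach M i j" "P j" "\<And>i k. 0 < M $ i $ k \<Longrightarrow> P k \<Longrightarrow> P i"
  shows "P i"
  using assms(1) unfolding reach_def
  by (induction rule: converse_rtranclp_induct) (use assms(2,3) in auto)

lemma reach_least: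
  assumes "reach M i j" "\<And>i. R i i" "\<And>i j k. R i j \<Longrightarrow> R j k \<Longrightarrow> R i k"
    "\<And>i j. 0 < M $ i $ j \<Longrightarrow> R i j"
  shows "R i j"
  by (rule reach_induct_backwards[OF assms(1), of "\<lambda>i. R i j"]) (use assms(2-) in blast)+

lemma cls_eq_iff:
  "cls (reach M) i = cls (reach M) j \<longleftrightarrow> reach M i j \<and> reach M j i"
  unfolding cls_def using reach_refl[of M] reach_trans[of M] by blast

lemma reachable_assoc_digraph: "i \<rightarrow>\<^sup>*\<^bsub>with_proj (assoc_digraph M)\<^esub> j \<longleftrightarrow> reach M i j"
proof -
  interpret wf_digraph "with_proj (assoc_digraph M)"
    by unfold_locales (auto simp: assoc_digraph_def)
  show ?thesis
  proof
    assume "i \<rightarrow>\<^sup>*\<^bsub>with_proj (assoc_digraph M)\<^esub> j"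
    then show "reach M i j"
      by (induction rule: reachable_induct)
        (auto simp: assoc_digraph_def intro: reach_refl reach_trans reach_edge)
  next
    assume "reach M i j"
    then show "i \<rightarrow>\<^sup>*\<^bsub>with_proj (assoc_digraph M)\<^esub> j"
    proof (induction rule: reach_induct_backwards)
      show "j \<rightarrow>\<^sup>*\<^bsub>with_proj (assoc_digraph M)\<^esub> j"
        by (rule reachable_refl) (simp add: assoc_digraph_def)
    next
      case (edge i k)
      then have "i \<rightarrow>\<^bsub>with_proj (assoc_digraph M)\<^esub> k" by (simp add: assoc_digraph_def)
      then show ?case using edge.IH by (rule adj_reachable_trans)
    qed
  qed
qed

lemma classes_eq: "classes M = range (cls (reach M))"
proof -
  interpret wf_digraph "with_proj (assoc_digraph M)"
    by unfold_locales (auto simp: assoc_digraph_def)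
  have "classes M = sccs_verts" by (simp add: classes_def sccs_verts_conv)
  also have "\<dots> = range (cls (reach M))"
  proof (intro set_eqI iffI)
    fix S assume S: "S \<in> sccs_verts"
    then obtain i where "i \<in> S" by (auto simp: in_sccs_verts_conv_reachable)
    with S have "S = cls (reach M) i"
      unfolding in_sccs_verts_conv_reachable reachable_assoc_digraph cls_def by blast
    then show "S \<in> range (cls (reach M))" by blast
  next
    fix S assume "S \<in> range (cls (reach M))"
    then show "S \<in> sccs_verts"
      unfolding in_sccs_verts_conv_reachable reachable_assoc_digraph cls_def
      using reach_refl[of M] reach_trans[of M] by fast
  qed
  finally show ?thesis .
qed

lemma class_access_iff:
  "class_access M (cls (reach M) i) (cls (reach M) j) \<longleftrightarrow> reach M i j"
proof -
  interpret wf_digraph "with_proj (reduced_digraph M)"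
    by unfold_locales (auto simp: reduced_digraph_def)
  have mem: "i \<in> cls (reach M) i" for i by (simp add: cls_def reach_refl)
  have vert: "cls (reach M) i \<in> verts (with_proj (reduced_digraph M))" for i
    by (auto simp: reduced_digraph_def classes_eq)
  show ?thesis unfolding class_access_def
  proof
    assume "cls (reach M) i \<rightarrow>\<^sup>*\<^bsub>with_proj (reduced_digraph M)\<^esub> cls (reach M) j"
    then have "\<forall>l\<in>cls (reach M) j. reach M i l"
    proof (induction rule: reachable_induct)
      case base
      then show ?case by (simp add: cls_def)
    next
      case (step y z)
      then obtain a b where ab: "a \<in> y" "b \<in> z" "0 < M $ a $ b" "z \<in> classes M"
        by (auto simp: reduced_digraph_def)
      then have "reach M i b" using step.IH reach_edge reach_trans by metis
      moreover have "reach M b l" if "l \<in> z" for l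
        using ab(2,4) that unfolding classes_eq cls_def by (auto intro: reach_trans)
      ultimately show ?case by (blast intro: reach_trans)
    qed
    then show "reach M i j" using mem by blast
  next
    assume "reach M i j"
    then show "cls (reach M) i \<rightarrow>\<^sup>*\<^bsub>with_proj (reduced_digraph M)\<^esub> cls (reach M) j"
    proof (induction rule: reach_induct_backwards)
      show "cls (reach M) j \<rightarrow>\<^sup>*\<^bsub>with_proj (reduced_digraph M)\<^esub> cls (reach M) j"
        using vert by (rule reachable_refl)
    next
      case (edge i k)
      have "(cls (reach M) i, cls (reach M) k) \<in> parcs (reduced_digraph M)"
        using edge(1) mem by (auto simp: reduced_digraph_def classes_eq)
      then have "cls (reach M) i \<rightarrow>\<^bsub>with_proj (reduced_digraph M)\<^esub> cls (reach M) k" by simp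
      then show ?case using edge.IH by (rule adj_reachable_trans)
    qed
  qed
qed

lemma transitive_closure_eqI:
  assumes "reach M = reach N"
  shows "transitive_closure_reduced_digraph M = transitive_closure_reduced_digraph N"
proof -
  have in_classes: "\<mu> \<in> classes M \<and> \<nu> \<in> classes M"
    if "class_access M \<mu> \<nu>" for \<mu> \<nu> and M :: "real^'n^'n"
  proof -
    interpret wf_digraph "with_proj (reduced_digraph M)"
      by unfold_locales (auto simp: reduced_digraph_def)
    show ?thesis using reachable_in_verts[of \<mu> \<nu>] that
      by (auto simp: class_access_def reduced_digraph_def)
  qed
  have cl: "classes M = classes N" using assms by (simp add: classes_eq)
  have access: "class_access M \<mu> \<nu> = class_access N \<mu> \<nu>"
    if "\<mu> \<in> classes N" "\<nu> \<in> classes N" for \<mu> \<nu>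
  proof -
    from that obtain i j where "\<mu> = cls (reach N) i" "\<nu> = cls (reach N) j"
      by (auto simp: classes_eq)
    then show ?thesis using class_access_iff[of N i j] class_access_iff[of M i j] assms by simp
  qed
  have "class_access M = class_access N"
    using in_classes[of M] in_classes[of N] access unfolding cl by blast
  then show ?thesis unfolding transitive_closure_reduced_digraph_def cl by simp
qed

section \<open>Perron roots and eigenvectors of a class\<close>

lemma prod_cyclic_shift:
  fixes g :: "nat \<Rightarrow> 'a::comm_monoid_mult"
  shows "(\<Prod>t<n. g (Suc t mod n)) = (\<Prod>t<n. g t)"
proof (cases n)
  case (Suc m)
  have "(\<Prod>t<Suc m. g (Suc t mod Suc m)) = (\<Prod>t<m. g (Suc t mod Suc m)) * g 0"
    by (simp del: mod_Suc_eq)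
  also have "(\<Prod>t<m. g (Suc t mod Suc m)) = (\<Prod>t<m. g (Suc t))"
    by (rule prod.cong) auto
  also have "\<dots> * g 0 = (\<Prod>t<Suc m. g t)"
    by (subst prod.lessThan_Suc_shift) (simp add: mult.commute)
  finally show ?thesis using Suc by simp
qed simp

text \<open>
  In the product of the inequalities along a closed walk the entries of x cancel, which bounds
  the cycle means; walking from each index to one that attains equality must close a cycle
  that attains the bound.
\<close>

lemma perron_root_eqI:
  fixes M :: "real^'n^'n"
  assumes M: "nonneg_mat M" and C: "C \<noteq> {}" and x: "\<And>i. i \<in> C \<Longrightarrow> 0 < x i"
    and le: "\<And>i k. i \<in> C \<Longrightarrow> k \<in> C \<Longrightarrow> M $ i $ k * x k \<le> \<theta> * x i"
    and att: "\<And>i. i \<in> C \<Longrightarrow> \<exists>k\<in>C. M $ i $ k * x k = \<theta> * x i"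
  shows "perron_root M C = \<theta>"
proof -
  obtain i0 where i0: "i0 \<in> C" using C by blast
  obtain k0 where k0: "k0 \<in> C" "M $ i0 $ k0 * x k0 = \<theta> * x i0" using att[OF i0] by blast
  have "0 \<le> \<theta> * x i0"
    using nonneg_matD[OF M, of i0 k0] x[OF k0(1)] by (simp flip: k0(2))
  then have \<theta>: "0 \<le> \<theta>" using x[OF i0] by (simp add: zero_le_mult_iff)
  have shift: "(\<Prod>t<length c. x (c ! (Suc t mod length c))) = (\<Prod>t<length c. x (c ! t))"
    for c by (rule prod_cyclic_shift[of "\<lambda>t. x (c ! t)"])
  have pos: "0 < (\<Prod>t<length c. x (c ! t))" if "set c \<subseteq> C" for c
    using that by (intro prod_pos) (use x nth_mem in blast)
  have upper: "cycle_gmean M c \<le> \<theta>" if c: "c \<noteq> []" "set c \<subseteq> C" for c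
  proof -
    let ?a = "\<lambda>t. M $ (c ! t) $ (c ! (Suc t mod length c))"
    have in_C: "c ! t \<in> C" if "t < length c" for t using that c by auto
    have "(\<Prod>t<length c. ?a t) * (\<Prod>t<length c. x (c ! t))
      = (\<Prod>t<length c. ?a t * x (c ! (Suc t mod length c)))"
      by (simp add: prod.distrib shift)
    also have "\<dots> \<le> (\<Prod>t<length c. \<theta> * x (c ! t))"
    proof (rule prod_mono)
      fix t assume t: "t \<in> {..<length c}"
      have "Suc t mod length c < length c" using c(1) by simp
      with t have s: "c ! t \<in> C" "c ! (Suc t mod length c) \<in> C" using in_C by blast+
      show "0 \<le> ?a t * x (c ! (Suc t mod length c)) \<and>
          ?a t * x (c ! (Suc t mod length c)) \<le> \<theta> * x (c ! t)"
        using le[OF s] x[OF s(2)] nonneg_matD[OF M] by simp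
    qed
    also have "\<dots> = \<theta> ^ length c * (\<Prod>t<length c. x (c ! t))"
      by (simp add: prod.distrib)
    finally have "(\<Prod>t<length c. ?a t) \<le> \<theta> ^ length c"
      using pos[OF c(2)] by simp
    then have "cycle_gmean M c \<le> root (length c) (\<theta> ^ length c)"
      unfolding cycle_gmean_def using c by simp
    then show ?thesis using \<theta> c by (simp add: real_root_power_cancel)
  qed
  obtain s where s: "\<And>i. i \<in> C \<Longrightarrow> s i \<in> C \<and> M $ i $ s i * x (s i) = \<theta> * x i"
    using bchoice[of C "\<lambda>i k. k \<in> C \<and> M $ i $ k * x k = \<theta> * x i"] att by blast
  have iter: "(s ^^ t) i0 \<in> C" for t by (induction t) (use i0 s in auto)
  have "\<not> inj_on (\<lambda>t. (s ^^ t) i0) (UNIV :: nat set)"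
    using finite_imageD[of "\<lambda>t. (s ^^ t) i0" UNIV] finite by blast
  then obtain a' b' where "a' \<noteq> b'" "(s ^^ a') i0 = (s ^^ b') i0"
    unfolding inj_on_def by blast
  then obtain a b where ab: "a < b" "(s ^^ a) i0 = (s ^^ b) i0"
    by (cases "a' < b'") (auto simp: not_less le_less)
  define j q where "j = (s ^^ a) i0" and "q = b - a"
  have q: "0 < q" and j: "(s ^^ q) j = j"
  proof -
    show "0 < q" using ab by (simp add: q_def)
    have "(s ^^ q) j = (s ^^ (q + a)) i0" by (simp add: j_def funpow_add)
    then show "(s ^^ q) j = j" using ab by (simp add: q_def j_def)
  qed
  have jC: "(s ^^ t) j \<in> C" for t
    using iter[of "t + a"] by (simp add: j_def funpow_add)
  define c where "c = map (\<lambda>t. (s ^^ t) j) [0..<q]"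
  have c: "c \<noteq> []" "set c \<subseteq> C" "length c = q" using q jC by (auto simp: c_def)
  have nth: "c ! t = (s ^^ t) j" "c ! (Suc t mod q) = s ((s ^^ t) j)" if "t < q" for t
  proof -
    show "c ! t = (s ^^ t) j" using that by (simp add: c_def)
    show "c ! (Suc t mod q) = s ((s ^^ t) j)"
    proof (cases "Suc t = q")
      case True
      then show ?thesis using j q by (auto simp: c_def)
    next
      case False
      then show ?thesis using that by (simp add: c_def)
    qed
  qed
  let ?P = "\<Prod>t<q. M $ (c ! t) $ (c ! (Suc t mod q))"
  have "?P * (\<Prod>t<q. x (c ! t)) = (\<Prod>t<q. M $ (c ! t) $ (c ! (Suc t mod q)) * x (c ! (Suc t mod q)))"
    using shift[of c] c(3) by (simp add: prod.distrib)
  also have "\<dots> = (\<Prod>t<q. \<theta> * x (c ! t))"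
    by (rule prod.cong) (use s jC nth in auto)
  also have "\<dots> = \<theta> ^ q * (\<Prod>t<q. x (c ! t))" by (simp add: prod.distrib)
  finally have "?P * (\<Prod>t<q. x (c ! t)) = \<theta> ^ q * (\<Prod>t<q. x (c ! t))" .
  moreover have "(\<Prod>t<q. x (c ! t)) \<noteq> 0" using pos[OF c(2)] c(3) by (metis less_irrefl)
  ultimately have "?P = \<theta> ^ q" by (rule iffD1[OF mult_right_cancel, rotated])
  then have "cycle_gmean M c = \<theta>"
    unfolding cycle_gmean_def using \<theta> q c(3) by (simp add: real_root_power_cancel)
  then show ?thesis unfolding perron_root_def
    by (intro cSup_eq_maximum) (use c upper in auto)
qed

definition restrict_mat :: "real^'n^'n \<Rightarrow> 'n set \<Rightarrow> real^'n^'n" where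
  "restrict_mat M C = (\<chi> i j. if i \<in> C \<and> j \<in> C then M $ i $ j else 0)"

lemma nonneg_restrict_mat: "nonneg_mat M \<Longrightarrow> nonneg_mat (restrict_mat M C)"
  by (simp add: nonneg_mat_def restrict_mat_def)

text \<open>
  If the class has an edge, every index in it has a predecessor in it, so the block maps no nonzero
  vector to zero and can be normalised to a map of the simplex. A fixed point given by the Brouwer
  theorem is an eigenvector, and strong connectivity makes all its entries positive.
\<close>

lemma class_eigenvector:
  fixes M :: "real^'n^'n"
  assumes M: "nonneg_mat M" and C: "C = cls (reach M) i0"
  obtains \<theta> z where "0 \<le> \<theta>" "\<And>i. i \<in> C \<Longrightarrow> 0 < z $ i" "\<And>i. i \<notin> C \<Longrightarrow> z $ i = 0"
    "restrict_mat M C \<otimes>\<^sub>v z = \<theta> *\<^sub>R z"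
proof (cases "\<exists>a\<in>C. \<exists>b\<in>C. 0 < M $ a $ b")
  case False
  let ?z = "(\<chi> i. if i \<in> C then 1 else 0) :: real^'n"
  have "restrict_mat M C $ i $ k = 0" for i k
    using False nonneg_matD[OF M, of i k] by (force simp: restrict_mat_def)
  then have "restrict_mat M C \<otimes>\<^sub>v ?z = 0 *\<^sub>R ?z"
    by (simp add: vec_eq_iff max_mult_vec_nth max_sum_def image_constant_conv)
  then show ?thesis using that[of 0 ?z] by auto
next
  case True
  define D where "D = restrict_mat M C"
  have D: "nonneg_mat D" unfolding D_def by (rule nonneg_restrict_mat[OF M])
  have D_nth: "D $ i $ k = (if i \<in> C \<and> k \<in> C then M $ i $ k else 0)" for i k
    by (simp add: D_def restrict_mat_def)
  have CI: "k \<in> C" if "i \<in> C" "j \<in> C" "reach M i k" "reach M k j" for i j k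
    using that unfolding C cls_def by (auto intro: reach_trans)
  have CR: "reach M i j" if "i \<in> C" "j \<in> C" for i j
    using that unfolding C cls_def by (auto intro: reach_trans)
  obtain a b where ab: "a \<in> C" "b \<in> C" "0 < M $ a $ b" using True by blast
  have pred: "\<exists>k\<in>C. 0 < M $ k $ j" if j: "j \<in> C" for j
  proof -
    have "(\<lambda>i j. 0 < M $ i $ j)\<^sup>*\<^sup>* b j" using CR[OF ab(2) j] by (simp add: reach_def)
    then show ?thesis
    proof (cases rule: rtranclp.cases)
      case rtrancl_refl
      then show ?thesis using ab by auto
    next
      case (rtrancl_into_rtrancl k)
      then have "reach M b k" "reach M k j" by (auto simp: reach_def)
      then have "k \<in> C" using CI ab(2) j by blast
      then show ?thesis using rtrancl_into_rtrancl by blast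
    qed
  qed
  define S where "S = {v :: real^'n. (\<forall>i. 0 \<le> v $ i) \<and> (\<forall>i\<in>-C. v $ i = 0) \<and> (\<Sum>i\<in>UNIV. v $ i) = 1}"
  define \<sigma> where "\<sigma> v = (\<Sum>i\<in>UNIV. (D \<otimes>\<^sub>v v) $ i)" for v
  define f where "f v = inverse (\<sigma> v) *\<^sub>R (D \<otimes>\<^sub>v v)" for v
  have Dv0: "0 \<le> (D \<otimes>\<^sub>v v) $ i" for v i using nonneg_vecD[OF nonneg_max_mult_vec] .
  have supp: "(D \<otimes>\<^sub>v v) $ i = 0" if "i \<notin> C" for v i
    using that by (simp add: max_mult_vec_nth D_nth max_sum_def image_constant_conv)
  have \<sigma>: "0 < \<sigma> v" if v: "v \<in> S" for v
  proof -
    obtain j where j: "v $ j \<noteq> 0" using v unfolding S_def by (force intro: ccontr)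
    then have jC: "j \<in> C" and vj: "0 < v $ j" using v by (auto simp: S_def less_le)
    obtain k where k: "k \<in> C" "0 < M $ k $ j" using pred[OF jC] by blast
    have "0 < D $ k $ j * v $ j" using k vj jC by (simp add: D_nth)
    then have "0 < (D \<otimes>\<^sub>v v) $ k" using max_mult_vec_upper[of D k j v] by linarith
    then show ?thesis unfolding \<sigma>_def by (intro sum_pos2[of UNIV k]) (auto simp: Dv0)
  qed
  have "closed S"
  proof -
    have "S = (\<Inter>i. {v. 0 \<le> v $ i}) \<inter> (\<Inter>i\<in>-C. {v. v $ i = 0}) \<inter> {v. (\<Sum>i\<in>UNIV. v $ i) = 1}"
      by (auto simp: S_def)
    then show ?thesis
      by (auto intro!: closed_Int closed_INT closed_Collect_le closed_Collect_eq continuous_intros)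
  qed
  moreover have "bounded S"
  proof (rule bounded_subset[OF bounded_cbox[of 0 "\<chi> i. 1"]])
    have "v $ i \<le> 1" if "v \<in> S" for v i
      using that member_le_sum[of i UNIV "\<lambda>i. v $ i"] by (auto simp: S_def)
    then show "S \<subseteq> cbox 0 (\<chi> i. 1)" by (auto simp: S_def mem_box_cart)
  qed
  ultimately have "compact S" by (simp add: compact_eq_bounded_closed)
  moreover have "convex S"
    unfolding S_def convex_def by (auto simp: sum.distrib simp flip: sum_distrib_left)
  moreover have "S \<noteq> {}"
  proof -
    have "axis a 1 \<in> S" using ab(1) by (auto simp: S_def axis_def)
    then show ?thesis by blast
  qed
  moreover have "continuous_on S f"
  proof -
    have "continuous_on S \<sigma>" unfolding \<sigma>_def by (intro continuous_intros continuous_on_max_mult_vec)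
    then show ?thesis unfolding f_def
      by (intro continuous_intros continuous_on_max_mult_vec) (use \<sigma> in \<open>auto dest: less_imp_neq[symmetric]\<close>)
  qed
  moreover have "f v \<in> S" if "v \<in> S" for v
  proof -
    have "(\<Sum>i\<in>UNIV. f v $ i) = inverse (\<sigma> v) * \<sigma> v"
      by (simp add: f_def \<sigma>_def sum_distrib_left)
    then have "(\<Sum>i\<in>UNIV. f v $ i) = 1" using \<sigma>[OF that] by simp
    then show ?thesis using \<sigma>[OF that] Dv0 supp by (auto simp: S_def f_def)
  qed
  ultimately obtain z where z: "z \<in> S" "f z = z"
    using brouwer[of S f] by blast
  have eig: "D \<otimes>\<^sub>v z = \<sigma> z *\<^sub>R z"
    using \<sigma>[OF z(1)] arg_cong[OF z(2), of "\<lambda>v. \<sigma> z *\<^sub>R v"] by (simp add: f_def)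
  obtain j where j: "z $ j \<noteq> 0" using z(1) unfolding S_def by (force intro: ccontr)
  then have jC: "j \<in> C" and zj: "0 < z $ j" using z(1) by (auto simp: S_def less_le)
  have "0 < z $ i" if i: "i \<in> C" for i
  proof -
    have "reach M i j" using CR i jC by blast
    then have "reach M i j \<and> (i \<in> C \<longrightarrow> 0 < z $ i)"
    proof (induction rule: reach_induct_backwards)
      show "reach M j j \<and> (j \<in> C \<longrightarrow> 0 < z $ j)" using zj reach_refl by blast
    next
      case (edge i k)
      have "0 < z $ i" if iC: "i \<in> C"
      proof -
        have kC: "k \<in> C" using CI[OF iC jC] reach_edge edge by blast
        then have "0 < D $ i $ k * z $ k" using edge iC by (simp add: D_nth)
        also have "\<dots> \<le> (D \<otimes>\<^sub>v z) $ i" by (rule max_mult_vec_upper)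
        also have "\<dots> = \<sigma> z * z $ i" by (simp add: eig)
        finally show ?thesis using \<sigma>[OF z(1)] by (simp add: zero_less_mult_iff)
      qed
      then show ?case using edge reach_edge reach_trans by blast
    qed
    then show ?thesis using i by blast
  qed
  then show ?thesis using that[of "\<sigma> z" z] eig \<sigma>[OF z(1)] z(1) by (auto simp: S_def D_def)
qed

section \<open>Common eigenvectors of a class\<close>

lemma finite_ratio_bound:
  fixes u z :: "real^'n"
  assumes "nonneg_vec u" "nonneg_vec z" "\<And>i. 0 < u $ i \<Longrightarrow> 0 < z $ i"
  obtains K where "0 < K" "\<And>i. u $ i \<le> K * z $ i"
proof -
  define K where "K = 1 + (\<Sum>i\<in>UNIV. u $ i / z $ i)"
  have ge0: "0 \<le> u $ i / z $ i" for i using assms(1,2) by (simp add: nonneg_vecD)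
  then have K: "0 < K" unfolding K_def by (simp add: sum_nonneg add_pos_nonneg)
  have "u $ i \<le> K * z $ i" for i
  proof (cases "0 < u $ i")
    case True
    then have z: "0 < z $ i" by (rule assms(3))
    have "u $ i / z $ i \<le> (\<Sum>i\<in>UNIV. u $ i / z $ i)"
      by (rule member_le_sum) (auto simp: ge0)
    then have "u $ i / z $ i \<le> K" by (simp add: K_def)
    then show ?thesis using z by (simp add: field_simps)
  next
    case False
    then show ?thesis using K nonneg_vecD[OF assms(2), of i]
      by (meson linorder_not_less mult_nonneg_nonneg order_le_less order_trans)
  qed
  then show ?thesis using K that by blast
qed

text \<open>
  The eigenvectors common to the matrices already treated, squeezed between multiples of the
  eigenvector of the next matrix, form a compact set that is closed under maxima and under the
  normalised action of the next matrix. The element with the largest coordinate sum is therefore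
  not increased by that action, and the fixed point lemma applies.
\<close>

lemma commuting_common_eigenvector:
  fixes D :: "'l \<Rightarrow> real^'n^'n" and C :: "'n set"
  assumes "finite I"
    and nonneg: "\<And>l. l \<in> I \<Longrightarrow> nonneg_mat (D l)"
    and comm: "\<And>l m. l \<in> I \<Longrightarrow> m \<in> I \<Longrightarrow> D l \<otimes>\<^sub>m D m = D m \<otimes>\<^sub>m D l"
    and eig: "\<And>l. l \<in> I \<Longrightarrow> \<exists>z. (\<forall>i. if i \<in> C then 0 < z $ i else z $ i = 0) \<and>
      D l \<otimes>\<^sub>v z = \<theta> l *\<^sub>R z"
    and \<theta>: "\<And>l. l \<in> I \<Longrightarrow> 0 \<le> \<theta> l"
  shows "\<exists>v. (\<forall>i. if i \<in> C then 0 < v $ i else v $ i = 0) \<and> (\<forall>l\<in>I. D l \<otimes>\<^sub>v v = \<theta> l *\<^sub>R v)"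
  using assms
proof (induction I rule: finite_induct)
  case empty
  show ?case by (rule exI[of _ "\<chi> i. if i \<in> C then 1 else 0"]) auto
next
  case (insert m I)
  from insert.IH[OF insert.prems(1-4)]
  obtain v where v: "\<And>i. if i \<in> C then 0 < v $ i else v $ i = 0"
      "\<And>l. l \<in> I \<Longrightarrow> D l \<otimes>\<^sub>v v = \<theta> l *\<^sub>R v"
    by auto
  from insert.prems(3)[of m]
  obtain z where z: "\<And>i. if i \<in> C then 0 < z $ i else z $ i = 0" "D m \<otimes>\<^sub>v z = \<theta> m *\<^sub>R z"
    by auto
  have Dm: "nonneg_mat (D m)" using insert.prems(1) by simp
  have nv: "nonneg_vec v" and nz: "nonneg_vec z"
    using v(1) z(1) unfolding nonneg_vec_def by (metis less_eq_real_def)+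
  obtain K1 where K1: "0 < K1" "\<And>i. v $ i \<le> K1 * z $ i"
    using finite_ratio_bound[OF nv nz] v(1) z(1) by (metis less_irrefl)
  obtain K2 where K2: "0 < K2" "\<And>i. z $ i \<le> K2 * v $ i"
    using finite_ratio_bound[OF nz nv] v(1) z(1) by (metis less_irrefl)
  show ?case
  proof (cases "\<theta> m = 0")
    case True
    have "(D m \<otimes>\<^sub>v v) $ i = 0" for i
    proof -
      have "(D m \<otimes>\<^sub>v v) $ i \<le> (D m \<otimes>\<^sub>v (K1 *\<^sub>R z)) $ i"
        by (rule max_mult_vec_mono[OF Dm]) (simp add: K1)
      also have "\<dots> = 0" using K1(1) z(2) True by (simp add: max_mult_vec_scaleR)
      finally show ?thesis using nonneg_vecD[OF nonneg_max_mult_vec, of "D m" v i] by linarith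
    qed
    then have "D m \<otimes>\<^sub>v v = \<theta> m *\<^sub>R v" using True by (simp add: vec_eq_iff)
    then show ?thesis using v by blast
  next
    case False
    then have \<theta>m: "0 < \<theta> m" using insert.prems(4)[of m] by simp
    define X where "X = {w. (\<forall>i. z $ i \<le> K2 * w $ i) \<and> (\<forall>i. w $ i \<le> K1 * z $ i) \<and>
      (\<forall>l\<in>I. D l \<otimes>\<^sub>v w = \<theta> l *\<^sub>R w)}"
    define T where "T w = inverse (\<theta> m) *\<^sub>R (D m \<otimes>\<^sub>v w)" for w
    have Xnn: "nonneg_vec w" if "w \<in> X" for w
    proof -
      have "0 \<le> K2 * w $ i" for i
        using that nonneg_vecD[OF nz, of i] order_trans[of 0 "z $ i" "K2 * w $ i"] by (simp add: X_def)
      then show ?thesis using K2(1) by (simp add: nonneg_vec_def zero_le_mult_iff)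
    qed
    have TX: "T w \<in> X" if w: "w \<in> X" for w
    proof -
      have "z $ i \<le> K2 * T w $ i" for i
      proof -
        have "\<theta> m * z $ i = (D m \<otimes>\<^sub>v z) $ i" by (simp add: z(2))
        also have "\<dots> \<le> (D m \<otimes>\<^sub>v (K2 *\<^sub>R w)) $ i"
          by (rule max_mult_vec_mono[OF Dm]) (use w in \<open>simp add: X_def\<close>)
        also have "\<dots> = K2 * (D m \<otimes>\<^sub>v w) $ i" using K2(1) by (simp add: max_mult_vec_scaleR)
        finally show ?thesis using \<theta>m by (simp add: T_def field_simps)
      qed
      moreover have "T w $ i \<le> K1 * z $ i" for i
      proof -
        have "(D m \<otimes>\<^sub>v w) $ i \<le> (D m \<otimes>\<^sub>v (K1 *\<^sub>R z)) $ i"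
          by (rule max_mult_vec_mono[OF Dm]) (use w in \<open>simp add: X_def\<close>)
        also have "\<dots> = \<theta> m * (K1 * z $ i)" using K1(1) by (simp add: max_mult_vec_scaleR z(2))
        finally show ?thesis using \<theta>m by (simp add: T_def field_simps)
      qed
      moreover have "D l \<otimes>\<^sub>v T w = \<theta> l *\<^sub>R T w" if l: "l \<in> I" for l
      proof -
        have "D l \<otimes>\<^sub>v T w = inverse (\<theta> m) *\<^sub>R (D l \<otimes>\<^sub>v (D m \<otimes>\<^sub>v w))"
          using \<theta>m by (simp add: T_def max_mult_vec_scaleR)
        also have "D l \<otimes>\<^sub>v (D m \<otimes>\<^sub>v w) = D m \<otimes>\<^sub>v (D l \<otimes>\<^sub>v w)"
          by (rule max_mult_vec_commute) (use insert.prems l Xnn[OF w] in auto)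
        also have "\<dots> = \<theta> l *\<^sub>R (D m \<otimes>\<^sub>v w)"
          using w l insert.prems(4)[of l] by (simp add: X_def max_mult_vec_scaleR)
        finally show ?thesis by (simp add: T_def)
      qed
      ultimately show ?thesis by (simp add: X_def)
    qed
    have "compact X"
    proof -
      have "X = (\<Inter>i. {w. z $ i \<le> K2 * w $ i}) \<inter> (\<Inter>i. {w. w $ i \<le> K1 * z $ i}) \<inter>
          (\<Inter>l\<in>I. {w. D l \<otimes>\<^sub>v w = \<theta> l *\<^sub>R w})"
        by (auto simp: X_def)
      moreover have "closed \<dots>"
        by (intro closed_Int closed_INT ballI closed_Collect_le closed_Collect_eq
            continuous_intros continuous_on_max_mult_vec)
      moreover have "X \<subseteq> cbox 0 (K1 *\<^sub>R z)"
        using Xnn by (auto simp: mem_box_cart nonneg_vec_def) (simp add: X_def)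
      then have "bounded X" using bounded_cbox bounded_subset by blast
      ultimately show ?thesis by (simp add: compact_eq_bounded_closed)
    qed
    have Tcont: "continuous_on X T"
      unfolding T_def by (intro continuous_intros continuous_on_max_mult_vec)
    have "v \<in> X" using v(2) K1 K2 by (simp add: X_def)
    moreover have "continuous_on X (\<lambda>u. \<Sum>i\<in>UNIV. u $ i)" by (intro continuous_intros)
    ultimately obtain u where u: "u \<in> X"
      "\<And>w. w \<in> X \<Longrightarrow> (\<Sum>i\<in>UNIV. w $ i) \<le> (\<Sum>i\<in>UNIV. u $ i)"
      using continuous_attains_sup[of X "\<lambda>u. \<Sum>i\<in>UNIV. u $ i"] \<open>compact X\<close> by blast
    have max_X: "vec_max u (T u) \<in> X"
    proof -
      have "D l \<otimes>\<^sub>v vec_max u (T u) = \<theta> l *\<^sub>R vec_max u (T u)" if "l \<in> I" for l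
      proof -
        have "D l \<otimes>\<^sub>v vec_max u (T u) = vec_max (\<theta> l *\<^sub>R u) (\<theta> l *\<^sub>R T u)"
          using that u(1) TX[OF u(1)] insert.prems(1) by (simp add: max_mult_vec_max X_def)
        also have "\<dots> = \<theta> l *\<^sub>R vec_max u (T u)"
          using insert.prems(4) that by (simp add: vec_max_def vec_eq_iff max_mult_distrib_left)
        finally show ?thesis .
      qed
      then show ?thesis using u(1) TX[OF u(1)] by (auto simp: X_def vec_max_def max_def)
    qed
    have "T u $ i \<le> u $ i" for i
    proof (rule ccontr)
      assume "\<not> T u $ i \<le> u $ i"
      then have "(\<Sum>i\<in>UNIV. u $ i) < (\<Sum>i\<in>UNIV. vec_max u (T u) $ i)"
        by (intro sum_strict_mono_ex1) (auto simp: vec_max_def intro!: exI[of _ i])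
      then show False using u(2)[OF max_X] by simp
    qed
    moreover have "T w $ i \<le> T w' $ i" if "\<And>i. w $ i \<le> w' $ i" for w w' i
      using max_mult_vec_mono[OF Dm, of w w' i] that \<theta>m by (simp add: T_def)
    ultimately obtain y where y: "y \<in> X" "T y = y"
      using compact_monotone_fixpoint[OF \<open>compact X\<close> Tcont TX _ u(1)] by blast
    have "D m \<otimes>\<^sub>v y = \<theta> m *\<^sub>R y"
      using \<theta>m arg_cong[OF y(2), of "\<lambda>v. \<theta> m *\<^sub>R v"] by (simp add: T_def)
    moreover have "if i \<in> C then 0 < y $ i else y $ i = 0" for i
    proof -
      have b: "z $ i \<le> K2 * y $ i" "y $ i \<le> K1 * z $ i" "0 \<le> y $ i"
        using y(1) nonneg_vecD[OF Xnn[OF y(1)]] by (auto simp: X_def)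
      show ?thesis
      proof (cases "i \<in> C")
        case True
        then have "0 < K2 * y $ i" using b(1) z(1)[of i] by auto
        then show ?thesis using True K2(1) by (simp add: zero_less_mult_iff)
      next
        case False
        then show ?thesis using b(2,3) z(1)[of i] by auto
      qed
    qed
    ultimately show ?thesis using y(1) by (intro exI[of _ y]) (simp add: X_def)
  qed
qed

lemma restrict_mat_mult:
  assumes "nonneg_mat M" "nonneg_mat N"
    "\<And>i k j. i \<in> C \<Longrightarrow> j \<in> C \<Longrightarrow> 0 < M $ i $ k \<Longrightarrow> 0 < N $ k $ j \<Longrightarrow> k \<in> C"
  shows "restrict_mat (M \<otimes>\<^sub>m N) C = restrict_mat M C \<otimes>\<^sub>m restrict_mat N C"
proof -
  have "max_sum (\<lambda>k. restrict_mat M C $ i $ k * restrict_mat N C $ k $ j) UNIV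
      = (if i \<in> C \<and> j \<in> C then max_sum (\<lambda>k. M $ i $ k * N $ k $ j) UNIV else 0)" for i j
  proof (cases "i \<in> C \<and> j \<in> C")
    case True
    have "restrict_mat M C $ i $ k * restrict_mat N C $ k $ j = M $ i $ k * N $ k $ j" for k
      using True assms(3)[of i j k] nonneg_matD[OF assms(1), of i k] nonneg_matD[OF assms(2), of k j]
      by (auto simp: restrict_mat_def less_le)
    then show ?thesis using True by simp
  next
    case False
    then have "(\<lambda>k. restrict_mat M C $ i $ k * restrict_mat N C $ k $ j) = (\<lambda>k. 0)"
      by (auto simp: restrict_mat_def)
    then show ?thesis using False by (auto simp: max_sum_def)
  qed
  then show ?thesis by (simp add: vec_eq_iff max_mult_nth) (simp add: restrict_mat_def max_mult_nth)
qed

text \<open>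
  The last two conditions say that on every class of R the diagonal block of M maps x to its
  multiple by the value of \<open>\<phi>\<close> on this class, with the maximum written out.
\<close>

definition adapted :: "('n \<Rightarrow> 'n \<Rightarrow> bool) \<Rightarrow> real^'n \<Rightarrow> real^'n^'n \<Rightarrow> ('n \<Rightarrow> real) \<Rightarrow> bool" where
  "adapted R x M \<phi> \<longleftrightarrow> nonneg_mat M \<and> (\<forall>i j. 0 < M $ i $ j \<longrightarrow> R i j) \<and>
     (\<forall>i j. R i j \<longrightarrow> R j i \<longrightarrow> \<phi> i = \<phi> j) \<and>
     (\<forall>i k. R i k \<longrightarrow> R k i \<longrightarrow> M $ i $ k * x $ k \<le> \<phi> i * x $ i) \<and>
     (\<forall>i. \<exists>k. R i k \<and> R k i \<and> M $ i $ k * x $ k = \<phi> i * x $ i)"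

lemma adapted_perron_root:
  assumes "adapted R x M \<phi>" "\<And>i. 0 < x $ i" "R i i" "\<And>i j k. R i j \<Longrightarrow> R j k \<Longrightarrow> R i k"
  shows "perron_root M (cls R i) = \<phi> i"
proof (rule perron_root_eqI)
  show "nonneg_mat M" using assms(1) by (simp add: adapted_def)
  show "cls R i \<noteq> {}" using assms(3) by (auto simp: cls_def)
  show "0 < x $ k" for k by (rule assms(2))
  have eq: "\<phi> k = \<phi> i" if "k \<in> cls R i" for k using that assms(1) by (auto simp: cls_def adapted_def)
  show "M $ k $ l * x $ l \<le> \<phi> i * x $ k" if "k \<in> cls R i" "l \<in> cls R i" for k l
  proof -
    have "R k l" "R l k" using that assms(4) unfolding cls_def by blast+
    then have "M $ k $ l * x $ l \<le> \<phi> k * x $ k" using assms(1) unfolding adapted_def by blast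
    then show ?thesis using eq[OF that(1)] by simp
  qed
  show "\<exists>l\<in>cls R i. M $ k $ l * x $ l = \<phi> i * x $ k" if k: "k \<in> cls R i" for k
  proof -
    obtain l where l: "R k l" "R l k" "M $ k $ l * x $ l = \<phi> k * x $ k"
      using assms(1) unfolding adapted_def by blast
    then have "l \<in> cls R i" using k unfolding cls_def by (blast intro: assms(4))
    then show ?thesis using l(3) eq[OF k] by metis
  qed
qed

text \<open>
  Paths between two indices of a class stay in the class, so the diagonal blocks commute as well.
  Their common eigenvectors on the different classes are glued to one vector.
\<close>

lemma commuting_adapted:
  fixes A :: "'l \<Rightarrow> real^'n^'n"
  assumes "finite I" and nn: "\<And>l. l \<in> I \<Longrightarrow> nonneg_mat (A l)"
    and comm: "\<And>l m. l \<in> I \<Longrightarrow> m \<in> I \<Longrightarrow> A l \<otimes>\<^sub>m A m = A m \<otimes>\<^sub>m A l"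
    and R: "\<And>l. l \<in> I \<Longrightarrow> reach (A l) = R" and ne: "I \<noteq> {}"
  shows "\<exists>x. (\<forall>i. 0 < x $ i) \<and>
    (\<forall>l\<in>I. adapted R x (A l) (\<lambda>i. perron_root (A l) (cls R i)))"
proof -
  obtain l0 where "l0 \<in> I" using ne by blast
  then have R_refl: "R i i" and R_trans: "R i j \<Longrightarrow> R j k \<Longrightarrow> R i k" for i j k
    using R reach_refl[of "A l0"] reach_trans[of "A l0"] by auto
  have edge: "R i j" if "l \<in> I" "0 < A l $ i $ j" for l i j
    using that R reach_edge by metis
  define \<Theta> where "\<Theta> i l = (SOME t. 0 \<le> t \<and> (\<exists>z. (\<forall>k. if k \<in> cls R i then 0 < z $ k else z $ k = 0) \<and>
      restrict_mat (A l) (cls R i) \<otimes>\<^sub>v z = t *\<^sub>R z))" for i l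
  have \<Theta>: "0 \<le> \<Theta> i l \<and> (\<exists>z. (\<forall>k. if k \<in> cls R i then 0 < z $ k else z $ k = 0) \<and>
      restrict_mat (A l) (cls R i) \<otimes>\<^sub>v z = \<Theta> i l *\<^sub>R z)" if l: "l \<in> I" for i l
  proof -
    obtain \<theta> z where "0 \<le> \<theta>" "\<And>k. k \<in> cls R i \<Longrightarrow> 0 < z $ k" "\<And>k. k \<notin> cls R i \<Longrightarrow> z $ k = 0"
      "restrict_mat (A l) (cls R i) \<otimes>\<^sub>v z = \<theta> *\<^sub>R z"
      using class_eigenvector[OF nn[OF l], of "cls R i" i] R[OF l] by blast
    then have "\<exists>t. 0 \<le> t \<and> (\<exists>z. (\<forall>k. if k \<in> cls R i then 0 < z $ k else z $ k = 0) \<and>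
      restrict_mat (A l) (cls R i) \<otimes>\<^sub>v z = t *\<^sub>R z)" by auto
    then show ?thesis unfolding \<Theta>_def by (rule someI_ex)
  qed
  have "\<exists>v. (\<forall>k. if k \<in> cls R i then 0 < v $ k else v $ k = 0) \<and>
      (\<forall>l\<in>I. restrict_mat (A l) (cls R i) \<otimes>\<^sub>v v = \<Theta> i l *\<^sub>R v)" for i
  proof (rule commuting_common_eigenvector[OF assms(1)])
    show "nonneg_mat (restrict_mat (A l) (cls R i))" if "l \<in> I" for l
      using nn that by (simp add: nonneg_restrict_mat)
    show "restrict_mat (A l) (cls R i) \<otimes>\<^sub>m restrict_mat (A m) (cls R i)
        = restrict_mat (A m) (cls R i) \<otimes>\<^sub>m restrict_mat (A l) (cls R i)" if "l \<in> I" "m \<in> I" for l m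
    proof -
      have "k \<in> cls R i" if "a \<in> cls R i" "b \<in> cls R i" "R a k" "R k b" for a b k
        using that unfolding cls_def by (auto intro: R_trans)
      then have "restrict_mat (A l \<otimes>\<^sub>m A m) (cls R i)
          = restrict_mat (A l) (cls R i) \<otimes>\<^sub>m restrict_mat (A m) (cls R i)"
        if "l \<in> I" "m \<in> I" for l m
        using that nn edge by (intro restrict_mat_mult) blast+
      then show ?thesis using that comm by metis
    qed
  qed (use \<Theta> in auto)
  then have "\<exists>v. (\<forall>k\<in>cls R i. 0 < v $ k) \<and> (\<forall>l\<in>I. \<exists>t. restrict_mat (A l) (cls R i) \<otimes>\<^sub>v v = t *\<^sub>R v)"
    for i by (rule ex_forward[of "\<lambda>v. (\<forall>k. if k \<in> cls R i then 0 < v $ k else v $ k = 0) \<and> (\<forall>l\<in>I. restrict_mat (A l) (cls R i) \<otimes>\<^sub>v v = \<Theta> i l *\<^sub>R v)"]) (auto split: if_splits)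
  then have "\<forall>C\<in>range (cls R). \<exists>v. (\<forall>k\<in>C. 0 < v $ k) \<and> (\<forall>l\<in>I. \<exists>t. restrict_mat (A l) C \<otimes>\<^sub>v v = t *\<^sub>R v)"
    by blast
  from bchoice[OF this] obtain V where "\<forall>C\<in>range (cls R). (\<forall>k\<in>C. 0 < V C $ k) \<and>
      (\<forall>l\<in>I. \<exists>t. restrict_mat (A l) C \<otimes>\<^sub>v V C = t *\<^sub>R V C)" by blast
  then have V: "\<And>i k. k \<in> cls R i \<Longrightarrow> 0 < V (cls R i) $ k"
      "\<And>i l. l \<in> I \<Longrightarrow> \<exists>t. restrict_mat (A l) (cls R i) \<otimes>\<^sub>v V (cls R i) = t *\<^sub>R V (cls R i)"
    by blast+
  define x where "x = (\<chi> i. V (cls R i) $ i)"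
  have self: "i \<in> cls R i" for i by (simp add: cls_def R_refl)
  have cls_eq: "cls R k = cls R i" if "k \<in> cls R i" for i k
    using that unfolding cls_def by (auto intro: R_trans)
  have x: "x $ k = V (cls R i) $ k" if "k \<in> cls R i" for i k
    using cls_eq[OF that] by (simp add: x_def)
  have x_pos: "0 < x $ i" for i using V(1)[OF self] by (simp add: x_def)
  have "adapted R x (A l) (\<lambda>i. perron_root (A l) (cls R i))" if l: "l \<in> I" for l
  proof -
    define t where "t i = (SOME t. restrict_mat (A l) (cls R i) \<otimes>\<^sub>v V (cls R i) = t *\<^sub>R V (cls R i))" for i
    have t: "restrict_mat (A l) (cls R i) \<otimes>\<^sub>v V (cls R i) = t i *\<^sub>R V (cls R i)" for i
      unfolding t_def using V(2)[OF l] by (rule someI_ex)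
    have t_cong: "t i = t k" if "R i k" "R k i" for i k
      using cls_eq[of k i] that by (simp add: t_def cls_def)
    have le: "A l $ i $ k * x $ k \<le> t i * x $ i" if "R i k" "R k i" for i k
    proof -
      have k: "k \<in> cls R i" using that by (simp add: cls_def)
      have "A l $ i $ k * x $ k = restrict_mat (A l) (cls R i) $ i $ k * V (cls R i) $ k"
        using self k by (simp add: restrict_mat_def x)
      also have "\<dots> \<le> (restrict_mat (A l) (cls R i) \<otimes>\<^sub>v V (cls R i)) $ i"
        by (rule max_mult_vec_upper)
      also have "\<dots> = t i * x $ i" by (simp add: t x[OF self])
      finally show ?thesis .
    qed
    have att: "\<exists>k. R i k \<and> R k i \<and> A l $ i $ k * x $ k = t i * x $ i" for i
    proof (cases "0 < t i * x $ i")
      case True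
      then have "0 < (restrict_mat (A l) (cls R i) \<otimes>\<^sub>v V (cls R i)) $ i" by (simp add: t x[OF self])
      then obtain k where k: "(restrict_mat (A l) (cls R i) \<otimes>\<^sub>v V (cls R i)) $ i
          = restrict_mat (A l) (cls R i) $ i $ k * V (cls R i) $ k"
        by (rule max_mult_vec_attained_pos)
      then have "restrict_mat (A l) (cls R i) $ i $ k * V (cls R i) $ k = t i * x $ i"
        by (simp add: t x[OF self])
      moreover from this True have kC: "k \<in> cls R i" by (auto simp: restrict_mat_def split: if_splits)
      ultimately have "A l $ i $ k * x $ k = t i * x $ i"
        using self by (simp add: restrict_mat_def x)
      then show ?thesis using kC by (auto simp: cls_def)
    next
      case False
      have "A l $ i $ i * x $ i = t i * x $ i"
        using le[of i i] R_refl False nonneg_matD[OF nn[OF l], of i i] x_pos[of i]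
        by (smt (verit) mult_nonneg_nonneg)
      then show ?thesis using R_refl by blast
    qed
    have ad: "adapted R x (A l) t"
      unfolding adapted_def using nn[OF l] edge[OF l] t_cong le att by blast
    have "perron_root (A l) (cls R i) = t i" for i
      by (rule adapted_perron_root[OF ad x_pos R_refl R_trans])
    then have "(\<lambda>i. perron_root (A l) (cls R i)) = t" by (rule ext)
    with ad show ?thesis by simp
  qed
  then show ?thesis using x_pos by blast
qed

section \<open>Matrices adapted to a preorder\<close>

lemma final_element:
  fixes Z :: "'n::finite set"
  assumes "Z \<noteq> {}" "\<And>i. R i i" "\<And>i j k. R i j \<Longrightarrow> R j k \<Longrightarrow> R i k"
  obtains i where "i \<in> Z" "\<And>k. k \<in> Z \<Longrightarrow> R i k \<Longrightarrow> R k i"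
proof -
  obtain i0 where "i0 \<in> Z" using assms(1) by blast
  then obtain i where i: "i \<in> Z" "\<And>k. k \<in> Z \<Longrightarrow> card {l. R i l} \<le> card {l. R k l}"
    using ex_has_least_nat[of "\<lambda>i. i \<in> Z" i0 "\<lambda>i. card {l. R i l}"] by blast
  have "R k i" if k: "k \<in> Z" "R i k" for k
  proof (rule ccontr)
    assume "\<not> R k i"
    then have "{l. R k l} \<subset> {l. R i l}" using k(2) assms(2,3) by blast
    then have "card {l. R k l} < card {l. R i l}" by (simp add: psubset_card_mono)
    then show False using i(2)[OF k(1)] by simp
  qed
  then show ?thesis using i(1) that by blast
qed

lemma finite_arg_max:
  fixes f :: "'n::finite \<Rightarrow> real"
  assumes "Z \<noteq> {}"
  obtains i where "i \<in> Z" "\<And>k. k \<in> Z \<Longrightarrow> f k \<le> f i"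
proof -
  have "Max (f ` Z) \<in> f ` Z" using assms by (intro Max_in) auto
  then obtain i where "i \<in> Z" "f i = Max (f ` Z)" by auto
  then show ?thesis using that[of i] by simp
qed

lemma finite_arg_min:
  fixes f :: "'n::finite \<Rightarrow> real"
  assumes "Z \<noteq> {}"
  obtains i where "i \<in> Z" "\<And>k. k \<in> Z \<Longrightarrow> f i \<le> f k"
proof -
  have "Min (f ` Z) \<in> f ` Z" using assms by (intro Min_in) auto
  then obtain i where "i \<in> Z" "f i = Min (f ` Z)" by auto
  then show ?thesis using that[of i] by simp
qed

locale scaled_preorder =
  fixes R :: "'n::finite \<Rightarrow> 'n \<Rightarrow> bool" and x :: "real^'n"
  assumes R_refl: "R i i" and R_trans: "R i j \<Longrightarrow> R j k \<Longrightarrow> R i k" and x_pos: "0 < x $ i"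
begin

lemma adaptedD:
  assumes "adapted R x M \<phi>"
  shows "nonneg_mat M" "0 < M $ i $ j \<Longrightarrow> R i j" "R i j \<Longrightarrow> R j i \<Longrightarrow> \<phi> i = \<phi> j"
    "R i j \<Longrightarrow> R j i \<Longrightarrow> M $ i $ j * x $ j \<le> \<phi> i * x $ i"
proof -
  note * = assms[unfolded adapted_def]
  show "nonneg_mat M" by (rule *[THEN conjunct1])
  show "0 < M $ i $ j \<Longrightarrow> R i j" by (rule *[THEN conjunct2, THEN conjunct1, rule_format])
  show "R i j \<Longrightarrow> R j i \<Longrightarrow> \<phi> i = \<phi> j"
    by (rule *[THEN conjunct2, THEN conjunct2, THEN conjunct1, rule_format])
  show "R i j \<Longrightarrow> R j i \<Longrightarrow> M $ i $ j * x $ j \<le> \<phi> i * x $ i"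
    by (rule *[THEN conjunct2, THEN conjunct2, THEN conjunct2, THEN conjunct1, rule_format])
qed

lemma adapted_attained:
  assumes "adapted R x M \<phi>"
  obtains k where "R i k" "R k i" "M $ i $ k * x $ k = \<phi> i * x $ i"
proof -
  have "\<exists>k. R i k \<and> R k i \<and> M $ i $ k * x $ k = \<phi> i * x $ i"
    using assms[unfolded adapted_def, THEN conjunct2, THEN conjunct2, THEN conjunct2, THEN conjunct2]
    by (rule spec)
  then show ?thesis using that by blast
qed

lemma adapted_root_nonneg:
  assumes "adapted R x M \<phi>"
  shows "0 \<le> \<phi> i"
proof -
  obtain k where k: "M $ i $ k * x $ k = \<phi> i * x $ i" using adapted_attained[OF assms] .
  have "0 \<le> \<phi> i * x $ i"
    using nonneg_matD[OF adaptedD(1)[OF assms], of i k] x_pos[of k] by (simp flip: k)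
  then show ?thesis using x_pos[of i] by (simp add: zero_le_mult_iff)
qed

text \<open>
  The entry attaining equality needs to be exhibited only where the root is positive, since the
  diagonal entry serves otherwise.
\<close>

lemma adaptedI:
  assumes nn: "nonneg_mat M" and "\<And>i j. 0 < M $ i $ j \<Longrightarrow> R i j"
    and "\<And>i j. R i j \<Longrightarrow> R j i \<Longrightarrow> \<phi> i = \<phi> j"
    and le: "\<And>i k. R i k \<Longrightarrow> R k i \<Longrightarrow> M $ i $ k * x $ k \<le> \<phi> i * x $ i"
    and att: "\<And>i. 0 < \<phi> i \<Longrightarrow> \<exists>k. R i k \<and> R k i \<and> \<phi> i * x $ i \<le> M $ i $ k * x $ k"
  shows "adapted R x M \<phi>"
proof -
  have "\<exists>k. R i k \<and> R k i \<and> M $ i $ k * x $ k = \<phi> i * x $ i" for i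
  proof (cases "0 < \<phi> i")
    case True
    then show ?thesis using att[OF True] le by (meson antisym)
  next
    case False
    then have "\<phi> i * x $ i \<le> 0" using x_pos[of i] by (simp add: mult_nonpos_nonneg)
    moreover have "0 \<le> M $ i $ i * x $ i"
      using nonneg_matD[OF nn, of i i] x_pos[of i] by simp
    ultimately have "M $ i $ i * x $ i = \<phi> i * x $ i" using le[OF R_refl R_refl, of i] by linarith
    then show ?thesis using R_refl by blast
  qed
  then show ?thesis unfolding adapted_def using assms by blast
qed

text \<open>
  Comparing the vector with the multiple of x that touches it from below (or, in the next lemma,
  from above) on the class.
\<close>

lemma class_root_le:
  assumes M: "adapted R x M \<phi>" and w: "\<And>k. R i k \<Longrightarrow> R k i \<Longrightarrow> 0 < w $ k"
    and le: "\<And>k. R i k \<Longrightarrow> R k i \<Longrightarrow> (M \<otimes>\<^sub>v w) $ k \<le> \<rho> * w $ k"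
  shows "\<phi> i \<le> \<rho>"
proof -
  have "cls R i \<noteq> {}" using R_refl by (auto simp: cls_def)
  then obtain k where kC: "k \<in> cls R i" and extremal: "\<And>l. l \<in> cls R i \<Longrightarrow> w $ k / x $ k \<le> w $ l / x $ l"
    using finite_arg_min[of "cls R i" "\<lambda>k. w $ k / x $ k"] by metis
  have k: "R i k" "R k i" using kC by (simp_all add: cls_def)
  have min: "w $ k / x $ k \<le> w $ l / x $ l" if "R i l" "R l i" for l
    using extremal that by (simp add: cls_def)
  obtain l where l: "R k l" "R l k" "M $ k $ l * x $ l = \<phi> k * x $ k"
    using adapted_attained[OF M] .
  have il: "R i l" "R l i" using k l R_trans by blast+
  define c where "c = w $ k / x $ k"
  have "c \<le> w $ l / x $ l" using min[OF il] by (simp add: c_def)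
  then have cx: "c * x $ l \<le> w $ l" using x_pos[of l] by (simp add: field_simps)
  have wk: "w $ k = c * x $ k" using x_pos[of k] by (simp add: c_def)
  have "\<phi> k * w $ k = M $ k $ l * (c * x $ l)" using l(3) by (simp add: wk mult.left_commute)
  also have "\<dots> \<le> M $ k $ l * w $ l"
    using cx nonneg_matD[OF adaptedD(1)[OF M]] by (intro mult_left_mono) auto
  also have "\<dots> \<le> (M \<otimes>\<^sub>v w) $ k" by (rule max_mult_vec_upper)
  also have "\<dots> \<le> \<rho> * w $ k" by (rule le[OF k])
  finally have "\<phi> k \<le> \<rho>" using w[OF k] by simp
  then show ?thesis using adaptedD(3)[OF M k] by simp
qed

lemma le_class_root:
  assumes M: "adapted R x M \<phi>" and w: "nonneg_vec w" "0 < w $ i"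
    and eq: "\<And>k. R i k \<Longrightarrow> R k i \<Longrightarrow> \<rho> * w $ k \<le> (M \<otimes>\<^sub>v w) $ k"
    and final: "\<And>k. R i k \<Longrightarrow> 0 < w $ k \<Longrightarrow> R k i"
  shows "\<rho> \<le> \<phi> i"
proof (cases "0 < \<rho>")
  case True
  have "cls R i \<noteq> {}" using R_refl by (auto simp: cls_def)
  then obtain k where kC: "k \<in> cls R i" and extremal: "\<And>l. l \<in> cls R i \<Longrightarrow> w $ l / x $ l \<le> w $ k / x $ k"
    using finite_arg_max[of "cls R i" "\<lambda>k. w $ k / x $ k"] by metis
  have k: "R i k" "R k i" using kC by (simp_all add: cls_def)
  have max: "w $ l / x $ l \<le> w $ k / x $ k" if "R i l" "R l i" for l
    using extremal that by (simp add: cls_def)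
  define c where "c = w $ k / x $ k"
  have wk: "w $ k = c * x $ k" using x_pos[of k] by (simp add: c_def)
  have "0 < w $ i / x $ i" using w(2) x_pos by simp
  also have "\<dots> \<le> c" using max[OF R_refl R_refl] by (simp add: c_def)
  finally have c: "0 < c" .
  then have wk_pos: "0 < w $ k" using x_pos[of k] by (simp add: wk)
  have pos: "0 < (M \<otimes>\<^sub>v w) $ k"
    using eq[OF k] mult_pos_pos[OF True wk_pos] by linarith
  then obtain l where l: "(M \<otimes>\<^sub>v w) $ k = M $ k $ l * w $ l" by (rule max_mult_vec_attained_pos)
  then have "M $ k $ l \<noteq> 0" "w $ l \<noteq> 0" using pos by auto
  then have Mkl: "0 < M $ k $ l" and wl: "0 < w $ l"
    using nonneg_matD[OF adaptedD(1)[OF M]] nonneg_vecD[OF w(1)] by (simp_all add: less_le)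
  have il: "R i l" using k(1) adaptedD(2)[OF M Mkl] R_trans by blast
  then have li: "R l i" using final wl by blast
  have "w $ l / x $ l \<le> c" using max[OF il li] by (simp add: c_def)
  then have wlc: "w $ l \<le> c * x $ l" using x_pos[of l] by (simp add: field_simps)
  have "\<rho> * w $ k \<le> M $ k $ l * w $ l" using eq[OF k] l by simp
  also have "\<dots> \<le> M $ k $ l * (c * x $ l)" using wlc Mkl by (intro mult_left_mono) auto
  also have "\<dots> = c * (M $ k $ l * x $ l)" by simp
  also have "\<dots> \<le> c * (\<phi> k * x $ k)"
    using adaptedD(4)[OF M R_trans[OF k(2) il] R_trans[OF li k(1)]] c by simp
  also have "\<dots> = \<phi> k * w $ k" by (simp add: wk)
  finally have "\<rho> \<le> \<phi> k" using wk_pos by simp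
  then show ?thesis using adaptedD(3)[OF M k] by simp
next
  case False
  then show ?thesis using adapted_root_nonneg[OF M, of i] by linarith
qed

section \<open>The eigenvector of a dominant class\<close>

text \<open>
  From an index in the class of j, an edge to an index that accesses j stays in the class, so the
  entries of v outside of the class do not contribute there.
\<close>

lemma class_supported_action:
  assumes M: "adapted R x M \<phi>" and v: "nonneg_vec v"
    and on: "\<And>i. R i j \<Longrightarrow> R j i \<Longrightarrow> v $ i = x $ i" and off: "\<And>i. \<not> R i j \<Longrightarrow> v $ i = 0"
  shows "R i j \<Longrightarrow> R j i \<Longrightarrow> (M \<otimes>\<^sub>v v) $ i = \<phi> j * x $ i"
    and "\<not> R i j \<Longrightarrow> (M \<otimes>\<^sub>v v) $ i = 0"
proof -
  have edge: "R i k" if "M $ i $ k \<noteq> 0" for i k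
    using adaptedD(2)[OF M, of i k] nonneg_matD[OF adaptedD(1)[OF M], of i k] that by linarith
  show "(M \<otimes>\<^sub>v v) $ i = \<phi> j * x $ i" if i: "R i j" "R j i"
  proof -
    have \<phi>: "\<phi> i = \<phi> j" using adaptedD(3)[OF M i] .
    have nn: "0 \<le> \<phi> j * x $ i" using adapted_root_nonneg[OF M, of j] x_pos[of i] by simp
    have le: "M $ i $ k * v $ k \<le> \<phi> j * x $ i" for k
    proof (cases "M $ i $ k = 0 \<or> v $ k = 0")
      case False
      then have "R i k" "R k j" using edge off by blast+
      then have "R i k" "R k i" "v $ k = x $ k" using i on R_trans by blast+
      then show ?thesis using adaptedD(4)[OF M, of i k] \<phi> by simp
    qed (use nn in auto)
    obtain k where k: "R i k" "R k i" "M $ i $ k * x $ k = \<phi> i * x $ i"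
      using adapted_attained[OF M] .
    then have "v $ k = x $ k" using i on R_trans by blast
    then have "M $ i $ k * v $ k = \<phi> j * x $ i" using k(3) \<phi> by simp
    then show ?thesis unfolding max_mult_vec_nth
      by (intro max_sum_eqI[of UNIV _ _ k]) (auto simp: le nn)
  qed
  show "(M \<otimes>\<^sub>v v) $ i = 0" if i: "\<not> R i j"
  proof -
    have "(\<lambda>k. M $ i $ k * v $ k) = (\<lambda>k. 0)"
      using edge[of i] off i R_trans by (intro ext) (metis mult_eq_0_iff)
    then show ?thesis by (simp add: max_mult_vec_nth max_sum_def)
  qed
qed

text \<open>
  Multiply x by a power of a large constant whose exponent counts the accessible indices. Then an
  edge to a different class lowers the exponent, and the constant absorbs the corresponding entry
  of M. The resulting vector is not increased by M divided by the root, and the fixed point lemma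
  finds the eigenvector below it.
\<close>

lemma dominant_class_eigenvector:
  assumes M: "adapted R x M \<phi>" and pos: "0 < \<phi> j" and dom: "\<And>i. R i j \<Longrightarrow> \<phi> i \<le> \<phi> j"
  obtains v where "nonneg_vec v" "M \<otimes>\<^sub>v v = \<phi> j *\<^sub>R v"
    "\<And>i. R i j \<Longrightarrow> R j i \<Longrightarrow> v $ i = x $ i" "\<And>i. \<not> R i j \<Longrightarrow> v $ i = 0"
proof -
  define \<rho> where "\<rho> = \<phi> j"
  have \<rho>: "0 < \<rho>" using pos by (simp add: \<rho>_def)
  have Mnn: "nonneg_mat M" using adaptedD(1)[OF M] .
  define h where "h i = card {l. R i l}" for i
  have h_eq: "h i = h k" if "R i k" "R k i" for i k
    using that R_trans unfolding h_def by (intro arg_cong[where f = card]) blast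
  have h_less: "h k < h i" if "R i k" "\<not> R k i" for i k
  proof -
    have "{l. R k l} \<subset> {l. R i l}" using that R_trans R_refl by blast
    then show ?thesis by (simp add: h_def psubset_card_mono)
  qed
  define K where "K = 1 + (\<Sum>i\<in>UNIV. \<Sum>k\<in>UNIV. M $ i $ k * x $ k / (\<rho> * x $ i))"
  have q0: "0 \<le> M $ i $ k * x $ k / (\<rho> * x $ i)" for i k
    using nonneg_matD[OF Mnn] x_pos[of i] x_pos[of k] \<rho> by simp
  have K1: "1 \<le> K" unfolding K_def using q0 by (simp add: sum_nonneg)
  have Kq: "M $ i $ k * x $ k \<le> \<rho> * (K * x $ i)" for i k
  proof -
    have "M $ i $ k * x $ k / (\<rho> * x $ i) \<le> (\<Sum>k\<in>UNIV. M $ i $ k * x $ k / (\<rho> * x $ i))"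
      using q0 by (intro member_le_sum) auto
    also have "\<dots> \<le> (\<Sum>i\<in>UNIV. \<Sum>k\<in>UNIV. M $ i $ k * x $ k / (\<rho> * x $ i))"
      using q0 by (intro member_le_sum[of i UNIV "\<lambda>i. \<Sum>k\<in>UNIV. M $ i $ k * x $ k / (\<rho> * x $ i)"])
        (auto intro: sum_nonneg)
    finally have "M $ i $ k * x $ k / (\<rho> * x $ i) \<le> K" by (simp add: K_def)
    then show ?thesis using \<rho> x_pos[of i] by (simp add: field_simps)
  qed
  \<comment> \<open>normalised to agree with x on the class of j, where the exponent vanishes\<close>
  define w where "w = (\<chi> i. if R i j then K ^ (h i - h j) * x $ i else 0)"
  have w_nn: "0 \<le> w $ i" for i using K1 x_pos[of i] by (simp add: w_def)
  have w_on: "w $ i = x $ i" if "R i j" "R j i" for i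
    using that h_eq[OF that] by (simp add: w_def)
  have h_ge: "h j \<le> h i" if "R i j" for i
    using that h_eq[of i j] h_less[of i j] by (cases "R j i") auto
  have w_super: "(M \<otimes>\<^sub>v w) $ i \<le> \<rho> * w $ i" for i
  proof (subst max_mult_vec_le_iff)
    show "0 \<le> \<rho> * w $ i" using \<rho> w_nn by simp
    show "\<forall>k. M $ i $ k * w $ k \<le> \<rho> * w $ i"
    proof
      fix k
      show "M $ i $ k * w $ k \<le> \<rho> * w $ i"
      proof (cases "M $ i $ k = 0 \<or> \<not> R k j")
        case True
        then have "M $ i $ k * w $ k = 0" by (auto simp: w_def)
        moreover have "0 \<le> \<rho> * w $ i" using \<rho> w_nn[of i] by simp
        ultimately show ?thesis by linarith
      next
        case False
        then have kj: "R k j" and ik: "R i k"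
          using adaptedD(2)[OF M, of i k] nonneg_matD[OF Mnn, of i k] by auto
        then have ij: "R i j" using R_trans by blast
        show ?thesis
        proof (cases "R k i")
          case True
          have "M $ i $ k * w $ k = K ^ (h i - h j) * (M $ i $ k * x $ k)"
            using kj h_eq[OF ik True] by (simp add: w_def)
          also have "\<dots> \<le> K ^ (h i - h j) * (\<rho> * x $ i)"
          proof (intro mult_left_mono)
            have "M $ i $ k * x $ k \<le> \<phi> i * x $ i" using adaptedD(4)[OF M ik True] .
            also have "\<dots> \<le> \<rho> * x $ i"
              using dom[OF ij] x_pos[of i] by (simp add: \<rho>_def)
            finally show "M $ i $ k * x $ k \<le> \<rho> * x $ i" .
          qed (use K1 in simp)
          finally show ?thesis using ij by (simp add: w_def mult.left_commute)
        next
          case False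
          have "Suc (h k - h j) \<le> h i - h j" using h_less[OF ik False] h_ge[OF kj] by linarith
          then have p: "K ^ (h k - h j) * K \<le> K ^ (h i - h j)"
            using power_increasing[of "Suc (h k - h j)" "h i - h j" K] K1 by (simp add: mult.commute)
          have "M $ i $ k * w $ k = K ^ (h k - h j) * (M $ i $ k * x $ k)"
            using kj by (simp add: w_def)
          also have "\<dots> \<le> K ^ (h k - h j) * (\<rho> * (K * x $ i))"
            using Kq K1 by (intro mult_left_mono) auto
          also have "\<dots> = (\<rho> * x $ i) * (K ^ (h k - h j) * K)" by simp
          also have "\<dots> \<le> (\<rho> * x $ i) * K ^ (h i - h j)"
            using p \<rho> x_pos[of i] by (intro mult_left_mono) auto
          finally show ?thesis using ij by (simp add: w_def mult_ac)
        qed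
      qed
    qed
  qed
  define X where "X = {v. (\<forall>i. 0 \<le> v $ i) \<and> (\<forall>i. v $ i \<le> w $ i) \<and>
    (\<forall>i. R i j \<and> R j i \<longrightarrow> v $ i = x $ i)}"
  define T where "T v = inverse \<rho> *\<^sub>R (M \<otimes>\<^sub>v v)" for v
  have X_off: "v $ i = 0" if "v \<in> X" "\<not> R i j" for v i
  proof -
    have "0 \<le> v $ i" "v $ i \<le> w $ i" using that(1) by (auto simp: X_def)
    moreover have "w $ i = 0" using that(2) by (simp add: w_def)
    ultimately show ?thesis by linarith
  qed
  have T_mono: "T u $ i \<le> T v $ i" if "\<And>i. u $ i \<le> v $ i" for u v i
    using max_mult_vec_mono[OF Mnn, of u v i] that \<rho> by (simp add: T_def)
  have Tw: "T w $ i \<le> w $ i" for i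
    using w_super[of i] \<rho> by (simp add: T_def field_simps)
  have TX: "T v \<in> X" if v: "v \<in> X" for v
  proof -
    have "T v $ i \<le> w $ i" for i
    proof -
      have "T v $ i \<le> T w $ i" by (rule T_mono) (use v in \<open>auto simp: X_def\<close>)
      then show ?thesis using Tw[of i] by linarith
    qed
    moreover have "0 \<le> T v $ i" for i
      using nonneg_vecD[OF nonneg_max_mult_vec, of M v i] \<rho> by (simp add: T_def)
    moreover have "T v $ i = x $ i" if i: "R i j" "R j i" for i
    proof -
      have on: "v $ i = x $ i" if "R i j" "R j i" for i using v that by (simp add: X_def)
      have "nonneg_vec v" using v by (simp add: X_def nonneg_vec_def)
      then have "(M \<otimes>\<^sub>v v) $ i = \<phi> j * x $ i"
        using class_supported_action(1)[OF M _ on X_off[OF v] i] by blast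
      then show ?thesis using \<rho> by (simp add: T_def \<rho>_def)
    qed
    ultimately show ?thesis by (simp add: X_def)
  qed
  have "compact X"
  proof -
    have "X = (\<Inter>i. {v. 0 \<le> v $ i}) \<inter> (\<Inter>i. {v. v $ i \<le> w $ i}) \<inter>
        (\<Inter>i\<in>{i. R i j \<and> R j i}. {v. v $ i = x $ i})"
      by (auto simp: X_def)
    moreover have "closed \<dots>"
      by (intro closed_Int closed_INT ballI closed_Collect_le closed_Collect_eq continuous_intros)
    moreover have "X \<subseteq> cbox 0 w" by (auto simp: X_def mem_box_cart)
    then have "bounded X" using bounded_cbox bounded_subset by blast
    ultimately show ?thesis by (simp add: compact_eq_bounded_closed)
  qed
  moreover have "continuous_on X T"
    unfolding T_def by (intro continuous_intros continuous_on_max_mult_vec)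
  moreover have "w \<in> X" using w_nn w_on by (simp add: X_def)
  ultimately obtain v where v: "v \<in> X" "T v = v"
    using compact_monotone_fixpoint[of X T w] TX T_mono Tw by blast
  have "M \<otimes>\<^sub>v v = \<rho> *\<^sub>R v" using \<rho> arg_cong[OF v(2), of "\<lambda>v. \<rho> *\<^sub>R v"] by (simp add: T_def)
  then show ?thesis using that[of v] v(1) X_off[OF v(1)]
    by (simp add: X_def \<rho>_def nonneg_vec_def)
qed

text \<open>
  Among the indices where u exceeds the multiple of v, take a final class, and in it the index
  where u is largest relative to x. The maximum in the eigenvalue equation cannot be attained
  outside the class, and inside it the root is too small.
\<close>

lemma eigenvector_dominated:
  assumes M: "adapted R x M \<phi>" and \<rho>: "0 < \<rho>"
    and dom: "\<And>i. R i j \<Longrightarrow> \<not> R j i \<Longrightarrow> \<phi> i < \<rho>"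
    and u: "nonneg_vec u" "M \<otimes>\<^sub>v u = \<rho> *\<^sub>R u" "\<And>i. \<not> R i j \<Longrightarrow> u $ i = 0"
    and v: "nonneg_vec v" "M \<otimes>\<^sub>v v = \<rho> *\<^sub>R v"
    and c: "0 \<le> c" "\<And>i. R i j \<Longrightarrow> R j i \<Longrightarrow> u $ i \<le> c * v $ i"
  shows "u $ i \<le> c * v $ i"
proof (rule ccontr)
  assume "\<not> u $ i \<le> c * v $ i"
  define Z where "Z = {i. c * v $ i < u $ i}"
  have "i \<in> Z" using \<open>\<not> u $ i \<le> c * v $ i\<close> by (simp add: Z_def)
  then have "Z \<noteq> {}" by blast
  then obtain i where i: "i \<in> Z" "\<And>k. k \<in> Z \<Longrightarrow> R i k \<Longrightarrow> R k i"
    using final_element[of Z R] R_refl R_trans by blast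
  have Mnn: "nonneg_mat M" using adaptedD(1)[OF M] .
  have cv: "0 \<le> c * v $ k" for k using c(1) nonneg_vecD[OF v(1)] by simp
  have upos: "0 < u $ k" if "k \<in> Z" for k using that cv[of k] by (simp add: Z_def)
  have ij: "R i j" "\<not> R j i" using i(1) upos[OF i(1)] u(3)[of i] c(2)[of i] by (auto simp: Z_def)
  have "\<phi> i < \<rho>" by (rule dom[OF ij])
  define Y where "Y = {k \<in> Z. R i k}"
  have "i \<in> Y" using R_refl i(1) by (simp add: Y_def)
  then have "Y \<noteq> {}" by blast
  then obtain k where kY: "k \<in> Y" and extremal: "\<And>l. l \<in> Y \<Longrightarrow> u $ l / x $ l \<le> u $ k / x $ k"
    using finite_arg_max[of Y "\<lambda>k. u $ k / x $ k"] by metis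
  have k: "k \<in> Z" "R i k" using kY by (simp_all add: Y_def)
  have max: "u $ l / x $ l \<le> u $ k / x $ k" if "l \<in> Z" "R i l" for l
    using extremal that by (simp add: Y_def)
  have ki: "R k i" using i(2) k by blast
  have lu: "(M \<otimes>\<^sub>v u) $ k = \<rho> * u $ k" by (simp add: u(2))
  then have "0 < (M \<otimes>\<^sub>v u) $ k" using \<rho> upos[OF k(1)] by simp
  then obtain l where l: "(M \<otimes>\<^sub>v u) $ k = M $ k $ l * u $ l" by (rule max_mult_vec_attained_pos)
  then have "0 < M $ k $ l * u $ l" using \<open>0 < (M \<otimes>\<^sub>v u) $ k\<close> by simp
  then have Mkl: "0 < M $ k $ l" using nonneg_matD[OF Mnn, of k l] by (auto simp: less_le)
  have "M $ k $ l * u $ l < \<rho> * u $ k"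
  proof (cases "l \<in> Z")
    case True
    have kl: "R k l" using adaptedD(2)[OF M Mkl] .
    then have il: "R i l" using k(2) R_trans by blast
    then have lk: "R l k" using i(2)[OF True] k(2) R_trans by blast
    define q where "q = u $ k / x $ k"
    have uk: "u $ k = q * x $ k" using x_pos[of k] by (simp add: q_def)
    have q: "0 < q" using upos[OF k(1)] x_pos[of k] by (simp add: q_def)
    have "u $ l / x $ l \<le> q" using max[OF True il] by (simp add: q_def)
    then have "u $ l \<le> q * x $ l" using x_pos[of l] by (simp add: field_simps)
    then have "M $ k $ l * u $ l \<le> q * (M $ k $ l * x $ l)"
      using Mkl by (simp add: mult.left_commute)
    also have "\<dots> \<le> q * (\<phi> k * x $ k)" using adaptedD(4)[OF M kl lk] q by simp
    also have "\<dots> = \<phi> i * u $ k" using adaptedD(3)[OF M k(2) ki] by (simp add: uk)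
    also have "\<dots> < \<rho> * u $ k" using \<open>\<phi> i < \<rho>\<close> upos[OF k(1)] by simp
    finally show ?thesis .
  next
    case False
    then have "M $ k $ l * u $ l \<le> c * (M $ k $ l * v $ l)"
      using Mkl by (simp add: Z_def mult.left_commute)
    also have "\<dots> \<le> c * (M \<otimes>\<^sub>v v) $ k" using c(1) max_mult_vec_upper by (intro mult_left_mono)
    also have "\<dots> = \<rho> * (c * v $ k)" by (simp add: v(2))
    also have "\<dots> < \<rho> * u $ k" using k(1) \<rho> by (simp add: Z_def)
    finally show ?thesis .
  qed
  then show False using l lu by simp
qed

text \<open>
  The image under N again satisfies the eigenvalue equation of M and vanishes on the indices without
  access to j. On the class of j it is a multiple of the original vector, hence by domination it
  is this multiple everywhere.
\<close>

lemma commuting_dominant_eigenvector: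
  assumes M: "adapted R x M \<phi>" and N: "adapted R x N \<psi>"
    and comm: "M \<otimes>\<^sub>m N = N \<otimes>\<^sub>m M"
    and pos: "0 < \<phi> j" and dom: "\<And>i. R i j \<Longrightarrow> \<not> R j i \<Longrightarrow> \<phi> i < \<phi> j"
    and v: "nonneg_vec v" "M \<otimes>\<^sub>v v = \<phi> j *\<^sub>R v"
      "\<And>i. R i j \<Longrightarrow> R j i \<Longrightarrow> v $ i = x $ i" "\<And>i. \<not> R i j \<Longrightarrow> v $ i = 0"
  shows "N \<otimes>\<^sub>v v = \<psi> j *\<^sub>R v"
proof -
  define u where "u = N \<otimes>\<^sub>v v"
  have u: "nonneg_vec u" unfolding u_def by (rule nonneg_max_mult_vec)
  have \<psi>: "0 \<le> \<psi> j" by (rule adapted_root_nonneg[OF N])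
  have u_on: "u $ i = \<psi> j * v $ i" if "R i j" "R j i" for i
    using class_supported_action(1)[OF N v(1,3,4) that] v(3)[OF that] by (simp add: u_def)
  have u_off: "u $ i = 0" if "\<not> R i j" for i
    using class_supported_action(2)[OF N v(1,3,4) that] by (simp add: u_def)
  have Mu: "M \<otimes>\<^sub>v u = \<phi> j *\<^sub>R u"
  proof -
    have "M \<otimes>\<^sub>v u = N \<otimes>\<^sub>v (M \<otimes>\<^sub>v v)" unfolding u_def
      by (rule max_mult_vec_commute[OF comm adaptedD(1)[OF M] adaptedD(1)[OF N] v(1)])
    then show ?thesis using pos by (simp add: v(2) max_mult_vec_scaleR u_def)
  qed
  have "u $ i = \<psi> j * v $ i" for i
  proof (rule antisym)
    show "u $ i \<le> \<psi> j * v $ i"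
      by (rule eigenvector_dominated[OF M pos dom u Mu u_off v(1,2) \<psi> eq_refl[OF u_on]])
    show "\<psi> j * v $ i \<le> u $ i"
    proof (cases "\<psi> j = 0")
      case True
      then show ?thesis using nonneg_vecD[OF u] by simp
    next
      case False
      then have p: "0 < \<psi> j" using \<psi> by simp
      have on: "v $ i \<le> inverse (\<psi> j) * u $ i" if "R i j" "R j i" for i
        using u_on[OF that] p by (simp add: field_simps)
      have "v $ i \<le> inverse (\<psi> j) * u $ i"
        by (rule eigenvector_dominated[OF M pos dom v(1,2,4) u Mu _ on]) (use p in simp_all)
      then show ?thesis using p by (simp add: field_simps)
    qed
  qed
  then show ?thesis by (simp add: vec_eq_iff u_def)
qed

end

section \<open>Commuting matrices have the same access relation\<close>

context scaled_preorder
begin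

text \<open>
  Extend x on the class by zero. Its image under B is again an eigenvector of A on the indices
  outside P, for the root of the class of j. A final class of its support has the same root, so
  by distinctness it is the class of j, which no other index outside P can access.
\<close>

lemma commuting_initial_class_closed:
  assumes R: "R = reach A" and A: "adapted R x A \<theta>"
    and distinct: "\<And>i k. \<theta> i = \<theta> k \<Longrightarrow> R i k"
    and B: "nonneg_mat B" and comm: "A \<otimes>\<^sub>m B = B \<otimes>\<^sub>m A"
    and P: "\<And>i k. R i k \<Longrightarrow> k \<in> P \<Longrightarrow> i \<in> P" "\<And>i k. 0 < B $ i $ k \<Longrightarrow> k \<in> P \<Longrightarrow> i \<in> P"
    and j: "j \<notin> P" "\<And>i. i \<notin> P \<Longrightarrow> R i j \<Longrightarrow> R j i"
    and l: "R l j" "R j l" and edge: "0 < B $ i $ l" and i: "i \<notin> P"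
  shows "R i j"
proof -
  have Ann: "nonneg_mat A" by (rule adaptedD(1)[OF A])
  have lP: "l \<notin> P" using P(1) l j(1) by blast
  define v where "v = (\<chi> k. if R k j \<and> R j k then x $ k else 0)"
  have v: "nonneg_vec v" using x_pos by (auto simp: v_def nonneg_vec_def less_imp_le)
  have Av: "(A \<otimes>\<^sub>v v) $ k = \<theta> j * v $ k" if k: "k \<notin> P" for k
  proof (cases "R k j")
    case True
    then have jk: "R j k" using j(2) k by blast
    obtain k' where k': "R k k'" "R k' k" "A $ k $ k' * x $ k' = \<theta> k * x $ k"
      using adapted_attained[OF A] .
    have \<theta>k: "\<theta> k = \<theta> j" using adaptedD(3)[OF A True jk] .
    have nn: "0 \<le> \<theta> j * v $ k"
      using adapted_root_nonneg[OF A, of j] nonneg_vecD[OF v, of k] by simp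
    have "A $ k $ b * v $ b \<le> \<theta> j * v $ k" for b
    proof (cases "R b j \<and> R j b")
      case b: True
      then have "R k b" "R b k" using True jk R_trans by blast+
      then show ?thesis using adaptedD(4)[OF A, of k b] b True jk \<theta>k by (simp add: v_def)
    next
      case False
      then show ?thesis using nn by (auto simp: v_def)
    qed
    moreover have "A $ k $ k' * v $ k' = \<theta> j * v $ k"
    proof -
      have "R k' j" "R j k'" using k' True jk R_trans by blast+
      then show ?thesis using k'(3) True jk \<theta>k by (simp add: v_def)
    qed
    ultimately show ?thesis unfolding max_mult_vec_nth
      by (intro max_sum_eqI[of UNIV _ _ k']) (auto simp: nn)
  next
    case False
    have "A $ k $ b * v $ b = 0" for b
    proof (cases "R b j \<and> R j b")
      case True
      then have "\<not> 0 < A $ k $ b" using adaptedD(2)[OF A, of k b] False R_trans by blast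
      then have "A $ k $ b = 0" using nonneg_matD[OF Ann, of k b] by linarith
      then show ?thesis by simp
    qed (auto simp: v_def)
    then have "(\<lambda>b. A $ k $ b * v $ b) = (\<lambda>b. 0)" by blast
    then show ?thesis using False by (simp add: max_mult_vec_nth max_sum_def v_def)
  qed
  define w where "w = B \<otimes>\<^sub>v v"
  have w: "nonneg_vec w" unfolding w_def by (rule nonneg_max_mult_vec)
  have Aw: "(A \<otimes>\<^sub>v w) $ k = \<theta> j * w $ k" if k: "k \<notin> P" for k
  proof -
    have "(A \<otimes>\<^sub>v w) $ k = (B \<otimes>\<^sub>v (A \<otimes>\<^sub>v v)) $ k"
      unfolding w_def using max_mult_vec_commute[OF comm Ann B v] by simp
    also have "\<dots> = max_sum (\<lambda>b. \<theta> j * (B $ k $ b * v $ b)) UNIV"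
      unfolding max_mult_vec_nth[of B]
    proof (rule max_sum_cong)
      fix b
      show "B $ k $ b * (A \<otimes>\<^sub>v v) $ b = \<theta> j * (B $ k $ b * v $ b)"
      proof (cases "b \<in> P")
        case True
        then have "\<not> 0 < B $ k $ b" using P(2)[of k b] k by blast
        then have "B $ k $ b = 0" using nonneg_matD[OF B, of k b] by linarith
        then show ?thesis by simp
      next
        case False
        then show ?thesis by (simp add: Av)
      qed
    qed
    also have "\<dots> = \<theta> j * w $ k"
      by (simp add: w_def max_mult_vec_nth max_sum_mult_left adapted_root_nonneg[OF A])
    finally show ?thesis .
  qed
  have "0 < B $ i $ l * v $ l" using edge l x_pos by (simp add: v_def)
  also have "\<dots> \<le> w $ i" unfolding w_def by (rule max_mult_vec_upper)
  finally have wi: "0 < w $ i" .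
  show ?thesis
  proof (cases "\<theta> j = 0")
    case True
    \<comment> \<open>A nonzero root would give a cycle through i, and A w would be positive where it enters i.\<close>
    have no_edge: "\<not> 0 < A $ k $ i" if "k \<notin> P" for k
    proof
      assume "0 < A $ k $ i"
      then have "0 < A $ k $ i * w $ i" using wi by simp
      also have "\<dots> \<le> (A \<otimes>\<^sub>v w) $ k" by (rule max_mult_vec_upper)
      finally show False using Aw[OF that] True by simp
    qed
    have "\<theta> i = 0"
    proof (rule ccontr)
      assume "\<theta> i \<noteq> 0"
      then have "0 < \<theta> i * x $ i" using adapted_root_nonneg[OF A, of i] x_pos[of i] by simp
      moreover obtain k where k: "R i k" "R k i" "A $ i $ k * x $ k = \<theta> i * x $ i"
        using adapted_attained[OF A] .
      ultimately have "0 < A $ i $ k * x $ k" by simp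
      then have ik: "0 < A $ i $ k" using x_pos[of k] by (simp add: zero_less_mult_iff less_not_sym)
      have "(\<lambda>i j. 0 < A $ i $ j)\<^sup>*\<^sup>* k i" using k(2) unfolding R reach_def .
      then show False
      proof (cases rule: rtranclp.cases)
        case rtrancl_refl
        then show False using no_edge i ik by blast
      next
        case (rtrancl_into_rtrancl b)
        then have "R k b" by (simp add: R reach_def)
        then have "R i b" using k(1) R_trans by blast
        then have "b \<notin> P" using P(1) i by blast
        then show False using no_edge rtrancl_into_rtrancl(2) by blast
      qed
    qed
    then show ?thesis using distinct[of i j] True by simp
  next
    case False
    then have \<theta>j: "0 < \<theta> j" using adapted_root_nonneg[OF A, of j] by simp
    define Z where "Z = {k. R i k \<and> 0 < w $ k}"
    have "i \<in> Z" using wi R_refl by (simp add: Z_def)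
    then have "Z \<noteq> {}" by blast
    then obtain b where b: "b \<in> Z" "\<And>k. k \<in> Z \<Longrightarrow> R b k \<Longrightarrow> R k b"
      using final_element[of Z R] R_refl R_trans by metis
    have ib: "R i b" and wb: "0 < w $ b" using b(1) by (simp_all add: Z_def)
    have bP: "k \<notin> P" if "R b k" for k using P(1) i ib that by blast
    have w_pos: "0 < w $ k" if bk: "R b k" and kb: "R k b" for k
    proof -
      have "reach A k b" using kb R by simp
      then have "k \<notin> P \<longrightarrow> 0 < w $ k"
      proof (induction rule: reach_induct_backwards)
        case base
        then show ?case using wb by simp
      next
        case (edge a c)
        show ?case
        proof
          assume a: "a \<notin> P"
          then have "c \<notin> P" using P(1) adaptedD(2)[OF A edge(1)] by blast
          then have "0 < A $ a $ c * w $ c" using edge by simp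
          also have "\<dots> \<le> (A \<otimes>\<^sub>v w) $ a" by (rule max_mult_vec_upper)
          also have "\<dots> = \<theta> j * w $ a" by (rule Aw[OF a])
          finally show "0 < w $ a" using \<theta>j by (simp add: zero_less_mult_iff)
        qed
      qed
      then show ?thesis using bP[OF bk] by simp
    qed
    have "\<theta> b \<le> \<theta> j"
      by (rule class_root_le[OF A w_pos]) (simp_all add: Aw bP)
    moreover have "\<theta> j \<le> \<theta> b"
    proof (rule le_class_root[OF A w wb])
      show "\<theta> j * w $ k \<le> (A \<otimes>\<^sub>v w) $ k" if "R b k" "R k b" for k
        using Aw[OF bP[OF that(1)]] by simp
      show "R k b" if "R b k" "0 < w $ k" for k
      proof -
        have "R i k" using ib that(1) R_trans by blast
        then show ?thesis using b(2)[of k] that by (simp add: Z_def)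
      qed
    qed
    ultimately have "R b j" using distinct[of b j] by simp
    then show ?thesis using ib R_trans by blast
  qed
qed

text \<open>
  A set closed under predecessors for A is shown to be closed for B by removing a final class
  from it. The class is then initial outside of the remaining set.
\<close>

lemma commuting_closed:
  assumes R: "R = reach A" and A: "adapted R x A \<theta>"
    and distinct: "\<And>i k. \<theta> i = \<theta> k \<Longrightarrow> R i k"
    and B: "nonneg_mat B" and comm: "A \<otimes>\<^sub>m B = B \<otimes>\<^sub>m A"
    and P: "\<And>i k. R i k \<Longrightarrow> k \<in> P \<Longrightarrow> i \<in> P"
    and edge: "0 < B $ i $ l" "l \<in> P"
  shows "i \<in> P"
  using finite[of P] P edge
proof (induction P arbitrary: i l rule: finite_psubset_induct)
  case (psubset P)
  have "P \<noteq> {}" using psubset.prems(3) by blast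
  then obtain j where j: "j \<in> P" "\<And>k. k \<in> P \<Longrightarrow> R j k \<Longrightarrow> R k j"
    using final_element[of P R] R_refl R_trans by metis
  define P0 where "P0 = P - {k. R k j \<and> R j k}"
  have "P0 \<subset> P" using j(1) R_refl by (auto simp: P0_def)
  have P0: "a \<in> P0" if "R a k" "k \<in> P0" for a k
  proof -
    have k: "k \<in> P" "\<not> (R k j \<and> R j k)" using that(2) by (simp_all add: P0_def)
    have "\<not> (R a j \<and> R j a)"
    proof
      assume "R a j \<and> R j a"
      then have "R j k" using that(1) R_trans by blast
      then show False using j(2)[OF k(1)] k(2) by blast
    qed
    then show ?thesis using psubset.prems(1)[OF that(1) k(1)] by (simp add: P0_def)
  qed
  have BP0: "a \<in> P0" if "0 < B $ a $ k" "k \<in> P0" for a k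
    by (rule psubset.IH[OF \<open>P0 \<subset> P\<close> P0 that])
  show ?case
  proof (cases "l \<in> P0 \<or> i \<in> P0")
    case True
    then have "i \<in> P0" using BP0[OF psubset.prems(2)] by blast
    then show ?thesis by (simp add: P0_def)
  next
    case False
    then have l: "R l j" "R j l" using psubset.prems(3) by (simp_all add: P0_def)
    have jP0: "j \<notin> P0" using R_refl by (simp add: P0_def)
    have init: "R j a" if "a \<notin> P0" "R a j" for a
      using psubset.prems(1)[OF that(2) j(1)] that by (simp add: P0_def)
    have "R i j"
      by (rule commuting_initial_class_closed[OF R A distinct B comm P0 BP0 jP0 init l
            psubset.prems(2)]) (use False in simp_all)
    then show ?thesis using psubset.prems(1) j(1) by blast
  qed
qed

end

lemma commuting_reach:
  fixes A B :: "real^'n^'n"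
  assumes A: "nonneg_mat A" and B: "nonneg_mat B" and comm: "A \<otimes>\<^sub>m B = B \<otimes>\<^sub>m A"
    and inj: "inj_on (perron_root A) (classes A)" and ij: "reach B i j"
  shows "reach A i j"
proof -
  obtain x where x: "\<forall>i. 0 < x $ i"
    "adapted (reach A) x A (\<lambda>i. perron_root A (cls (reach A) i))"
    using commuting_adapted[of "{()}" "\<lambda>_. A" "reach A"] A by auto
  interpret scaled_preorder "reach A" x
    by unfold_locales (auto simp: x reach_refl intro: reach_trans)
  have distinct: "reach A i k"
    if "perron_root A (cls (reach A) i) = perron_root A (cls (reach A) k)" for i k
  proof -
    have "cls (reach A) i = cls (reach A) k"
      using inj that by (rule inj_onD) (simp_all add: classes_eq)
    then show ?thesis by (simp add: cls_eq_iff)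
  qed
  have edge: "reach A a b" if "0 < B $ a $ b" for a b
  proof -
    have "a \<in> {a. reach A a b}"
      by (rule commuting_closed[OF refl x(2) distinct B comm _ that])
        (auto intro: reach_trans reach_refl)
    then show ?thesis by simp
  qed
  show ?thesis by (rule reach_least[OF ij]) (auto intro: reach_refl reach_trans edge)
qed

section \<open>Spectral classes and eigenvalues\<close>

text \<open>
  Spectrality of a class, stated for one of its indices and for an arbitrary assignment of roots.
\<close>

definition spectral_node :: "('n \<Rightarrow> 'n \<Rightarrow> bool) \<Rightarrow> ('n \<Rightarrow> real) \<Rightarrow> 'n \<Rightarrow> bool" where
  "spectral_node R \<theta> j \<longleftrightarrow>
     (\<forall>i. R i j \<longrightarrow> R j i) \<or> (0 < \<theta> j \<and> (\<forall>i. R i j \<longrightarrow> \<theta> i \<le> \<theta> j))"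

lemma spectral_classes_eq:
  "spectral_classes M = cls (reach M) `
     {j. spectral_node (reach M) (\<lambda>i. perron_root M (cls (reach M) i)) j}"
proof -
  have "cls (reach M) j \<in> spectral_classes M \<longleftrightarrow>
      spectral_node (reach M) (\<lambda>i. perron_root M (cls (reach M) i)) j" for j
    unfolding spectral_classes_def spectral_node_def initial_class_def classes_eq
    by (auto simp: class_access_iff cls_eq_iff)
  moreover have "spectral_classes M \<subseteq> range (cls (reach M))"
    by (auto simp: spectral_classes_def classes_eq)
  ultimately show ?thesis by blast
qed

context scaled_preorder
begin

lemma support_closed:
  assumes R: "R = reach A" and "\<And>i k. 0 < A $ i $ k \<Longrightarrow> 0 < v $ k \<Longrightarrow> 0 < v $ i"
    and "R i k" "0 < v $ k"
  shows "0 < v $ i"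
proof -
  have "reach A i k" using assms(3) R by simp
  then show ?thesis
    by (induction rule: reach_induct_backwards) (use assms(2,4) in blast)+
qed

text \<open>
  The eigenvector of M belonging to the dominant class is an eigenvector of A as well. If its
  eigenvalue for A is positive, then its support contains all indices that access the class, and
  this bounds their roots. If the eigenvalue is zero, then A has no edge into the class.
\<close>

lemma dominant_class_spectral:
  assumes M: "adapted R x M \<phi>" and A: "adapted R x A \<theta>" and R: "R = reach A"
    and comm: "M \<otimes>\<^sub>m A = A \<otimes>\<^sub>m M"
    and pos: "0 < \<phi> j" and dom: "\<And>i. R i j \<Longrightarrow> \<not> R j i \<Longrightarrow> \<phi> i < \<phi> j"
  shows "spectral_node R \<theta> j"
proof -
  have dom': "\<phi> i \<le> \<phi> j" if "R i j" for i
    using dom[OF that] adaptedD(3)[OF M that] by (cases "R j i") auto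
  obtain v where v: "nonneg_vec v" "M \<otimes>\<^sub>v v = \<phi> j *\<^sub>R v"
      "\<And>i. R i j \<Longrightarrow> R j i \<Longrightarrow> v $ i = x $ i" "\<And>i. \<not> R i j \<Longrightarrow> v $ i = 0"
    using dominant_class_eigenvector[OF M pos dom'] by metis
  have Av: "A \<otimes>\<^sub>v v = \<theta> j *\<^sub>R v"
    by (rule commuting_dominant_eigenvector[OF M A comm pos dom v])
  have vj: "0 < v $ j" using v(3)[of j] R_refl x_pos by simp
  show ?thesis
  proof (cases "\<theta> j = 0")
    case True
    have no_edge: "\<not> 0 < A $ i $ j" for i
    proof
      assume "0 < A $ i $ j"
      then have "0 < A $ i $ j * v $ j" using vj by simp
      also have "\<dots> \<le> (A \<otimes>\<^sub>v v) $ i" by (rule max_mult_vec_upper)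
      finally show False using Av True by simp
    qed
    have "R j i" if "R i j" for i
    proof -
      have "(\<lambda>i j. 0 < A $ i $ j)\<^sup>*\<^sup>* i j" using that unfolding R reach_def .
      then show ?thesis
        by (cases rule: rtranclp.cases) (use R_refl no_edge in auto)
    qed
    then show ?thesis by (simp add: spectral_node_def)
  next
    case False
    then have \<theta>j: "0 < \<theta> j" using adapted_root_nonneg[OF A, of j] by simp
    have step: "0 < v $ i" if "0 < A $ i $ k" "0 < v $ k" for i k
    proof -
      have "0 < A $ i $ k * v $ k" using that by simp
      also have "\<dots> \<le> (A \<otimes>\<^sub>v v) $ i" by (rule max_mult_vec_upper)
      finally show ?thesis using \<theta>j by (simp add: Av zero_less_mult_iff)
    qed
    have "\<theta> i \<le> \<theta> j" if i: "R i j" for i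
    proof (rule class_root_le[OF A])
      show "0 < v $ k" if "R k i" for k
        by (rule support_closed[OF R _ R_trans[OF that i] vj]) (rule step)
      show "(A \<otimes>\<^sub>v v) $ k \<le> \<theta> j * v $ k" for k by (simp add: Av)
    qed
    then show ?thesis using \<theta>j by (simp add: spectral_node_def)
  qed
qed

lemma spectral_strictly_dominant:
  assumes A: "adapted R x A \<theta>" and distinct: "\<And>i k. \<theta> i = \<theta> k \<Longrightarrow> R i k"
    and dom: "\<forall>i. R i j \<longrightarrow> \<theta> i \<le> \<theta> j" and i: "R i j" "\<not> R j i"
  shows "\<theta> i < \<theta> j"
  using dom i distinct[of j i] by (metis less_le)

lemma spectral_node_transfer:
  assumes A: "adapted R x A \<theta>" and distinct: "\<And>i k. \<theta> i = \<theta> k \<Longrightarrow> R i k"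
    and B: "adapted R x B \<psi>" and R: "R = reach B" and comm: "A \<otimes>\<^sub>m B = B \<otimes>\<^sub>m A"
    and j: "spectral_node R \<theta> j"
  shows "spectral_node R \<psi> j"
proof (cases "\<forall>i. R i j \<longrightarrow> R j i")
  case True
  then show ?thesis by (simp add: spectral_node_def)
next
  case False
  then have pos: "0 < \<theta> j" and dom: "\<forall>i. R i j \<longrightarrow> \<theta> i \<le> \<theta> j"
    using j unfolding spectral_node_def by blast+
  show ?thesis
    by (rule dominant_class_spectral[OF A B R comm pos spectral_strictly_dominant[OF A distinct dom]])
qed

text \<open>
  For the inclusion from left to right, take an eigenvector of M with maximal support. Its support
  is closed under predecessors, because applying A preserves the eigenvalue
  equation. All roots on the support are at most the eigenvalue, and a final class of the support
  attains it. A class attaining it that no other such class accesses is strictly dominant.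
\<close>

lemma eigenvalues_eq_spectral_roots:
  assumes M: "adapted R x M \<phi>" and A: "adapted R x A \<theta>" and R: "R = reach A"
    and distinct: "\<And>i k. \<theta> i = \<theta> k \<Longrightarrow> R i k" and comm: "M \<otimes>\<^sub>m A = A \<otimes>\<^sub>m M"
  shows "max_eigenvalues M = \<phi> ` {j. spectral_node R \<theta> j}"
proof (intro set_eqI iffI)
  fix \<alpha> assume "\<alpha> \<in> \<phi> ` {j. spectral_node R \<theta> j}"
  then obtain j where j: "spectral_node R \<theta> j" and \<alpha>: "\<alpha> = \<phi> j" by blast
  have "\<exists>v. nonneg_vec v \<and> 0 < v $ j \<and> M \<otimes>\<^sub>v v = \<phi> j *\<^sub>R v"
  proof (cases "\<forall>i. R i j \<longrightarrow> R j i")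
    case True
    define v where "v = (\<chi> k. if R k j then x $ k else 0)"
    have v: "nonneg_vec v" using x_pos by (auto simp: v_def nonneg_vec_def less_imp_le)
    have on: "v $ i = x $ i" if "R i j" "R j i" for i using that by (simp add: v_def)
    have off: "v $ i = 0" if "\<not> R i j" for i using that by (simp add: v_def)
    have "(M \<otimes>\<^sub>v v) $ i = \<phi> j * v $ i" for i
    proof (cases "R i j")
      case ij: True
      then show ?thesis using class_supported_action(1)[OF M v on off ij] True on by auto
    next
      case False
      then show ?thesis using class_supported_action(2)[OF M v on off False] off by auto
    qed
    then have "M \<otimes>\<^sub>v v = \<phi> j *\<^sub>R v" by (simp add: vec_eq_iff)
    then show ?thesis using v R_refl x_pos[of j] by (intro exI[of _ v]) (simp add: v_def)
  next
    case False
    then have pos: "0 < \<theta> j" and dom: "\<forall>i. R i j \<longrightarrow> \<theta> i \<le> \<theta> j"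
      using j unfolding spectral_node_def by blast+
    obtain v where v: "nonneg_vec v" "A \<otimes>\<^sub>v v = \<theta> j *\<^sub>R v"
        "\<And>i. R i j \<Longrightarrow> R j i \<Longrightarrow> v $ i = x $ i" "\<And>i. \<not> R i j \<Longrightarrow> v $ i = 0"
      using dominant_class_eigenvector[OF A pos] dom by metis
    have "M \<otimes>\<^sub>v v = \<phi> j *\<^sub>R v"
      by (rule commuting_dominant_eigenvector[OF A M comm[symmetric] pos
            spectral_strictly_dominant[OF A distinct dom] v])
    then show ?thesis using v(1) v(3)[OF R_refl R_refl] x_pos[of j] by (intro exI[of _ v]) simp
  qed
  then obtain v where v: "nonneg_vec v" "0 < v $ j" "M \<otimes>\<^sub>v v = \<phi> j *\<^sub>R v" by blast
  then have "v \<noteq> 0" by auto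
  then show "\<alpha> \<in> max_eigenvalues M"
    using v adapted_root_nonneg[OF M, of j] unfolding max_eigenvalues_def \<alpha> by blast
next
  fix \<alpha> assume "\<alpha> \<in> max_eigenvalues M"
  then obtain v0 where \<alpha>: "0 \<le> \<alpha>" and v0: "nonneg_vec v0" "v0 \<noteq> 0" "M \<otimes>\<^sub>v v0 = \<alpha> *\<^sub>R v0"
    unfolding max_eigenvalues_def by blast
  have Mnn: "nonneg_mat M" and Ann: "nonneg_mat A" using adaptedD(1) M A by blast+
  define E where "E v \<longleftrightarrow> nonneg_vec v \<and> v \<noteq> 0 \<and> M \<otimes>\<^sub>v v = \<alpha> *\<^sub>R v" for v
  define s where "s v = card {i. 0 < v $ i}" for v :: "real^'n"
  have "s v \<le> card (UNIV :: 'n set)" for v unfolding s_def by (intro card_mono) auto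
  then have bound: "\<forall>v. E v \<longrightarrow> s v < Suc (card (UNIV :: 'n set))" by (simp add: le_imp_less_Suc)
  have "E v0" using v0 by (simp add: E_def)
  from ex_has_greatest_nat[OF this bound]
  obtain v where Ev: "E v" and smax: "\<And>u. E u \<Longrightarrow> s u \<le> s v" by blast
  have v: "nonneg_vec v" "v \<noteq> 0" "M \<otimes>\<^sub>v v = \<alpha> *\<^sub>R v" using Ev by (simp_all add: E_def)
  \<comment> \<open>Otherwise the maximum of v and A v would be an eigenvector with larger support.\<close>
  have step: "0 < v $ i" if "0 < A $ i $ k" "0 < v $ k" for i k
  proof (rule ccontr)
    assume vi: "\<not> 0 < v $ i"
    define u where "u = vec_max v (A \<otimes>\<^sub>v v)"
    have u_ge: "v $ l \<le> u $ l" for l by (simp add: u_def vec_max_def)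
    have "M \<otimes>\<^sub>v (A \<otimes>\<^sub>v v) = A \<otimes>\<^sub>v (M \<otimes>\<^sub>v v)"
      by (rule max_mult_vec_commute[OF comm Mnn Ann v(1)])
    also have "\<dots> = \<alpha> *\<^sub>R (A \<otimes>\<^sub>v v)" by (simp add: v(3) max_mult_vec_scaleR \<alpha>)
    finally have "M \<otimes>\<^sub>v u = vec_max (\<alpha> *\<^sub>R v) (\<alpha> *\<^sub>R (A \<otimes>\<^sub>v v))"
      by (simp add: u_def max_mult_vec_max[OF Mnn] v(3))
    also have "\<dots> = \<alpha> *\<^sub>R u" using \<alpha> by (simp add: u_def vec_max_def vec_eq_iff max_mult_distrib_left)
    finally have "M \<otimes>\<^sub>v u = \<alpha> *\<^sub>R u" .
    moreover have "nonneg_vec u" unfolding nonneg_vec_def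
      using nonneg_vecD[OF v(1)] u_ge by (meson order_trans)
    moreover have ui: "0 < u $ i"
    proof -
      have "0 < A $ i $ k * v $ k" using that by simp
      also have "\<dots> \<le> (A \<otimes>\<^sub>v v) $ i" by (rule max_mult_vec_upper)
      also have "\<dots> \<le> u $ i" by (simp add: u_def vec_max_def)
      finally show ?thesis .
    qed
    then have "u \<noteq> 0" by auto
    ultimately have "E u" by (simp add: E_def)
    have "{l. 0 < v $ l} \<subset> {l. 0 < u $ l}" using u_ge ui vi less_le_trans by blast
    then have "s v < s u" unfolding s_def by (intro psubset_card_mono) auto
    then show False using smax[OF \<open>E u\<close>] by simp
  qed
  define Z where "Z = {i. 0 < v $ i}"
  have Z: "i \<in> Z" if "R i k" "k \<in> Z" for i k
    using support_closed[OF R step that(1)] that(2) by (simp add: Z_def)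
  obtain i0 where "v $ i0 \<noteq> 0" using v(2) by (auto simp: vec_eq_iff)
  then have "i0 \<in> Z" using nonneg_vecD[OF v(1), of i0] by (simp add: Z_def)
  then have "Z \<noteq> {}" by blast
  have le: "\<phi> i \<le> \<alpha>" if "i \<in> Z" for i
  proof (rule class_root_le[OF M])
    show "0 < v $ k" if "R k i" for k using Z[OF that \<open>i \<in> Z\<close>] by (simp add: Z_def)
    show "(M \<otimes>\<^sub>v v) $ k \<le> \<alpha> * v $ k" for k by (simp add: v(3))
  qed
  obtain b where b: "b \<in> Z" "\<And>k. k \<in> Z \<Longrightarrow> R b k \<Longrightarrow> R k b"
    using final_element[OF \<open>Z \<noteq> {}\<close>, of R] R_refl R_trans by metis
  have "\<alpha> \<le> \<phi> b"
  proof (rule le_class_root[OF M v(1)])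
    show "0 < v $ b" using b(1) by (simp add: Z_def)
    show "\<alpha> * v $ k \<le> (M \<otimes>\<^sub>v v) $ k" for k by (simp add: v(3))
    show "R k b" if "R b k" "0 < v $ k" for k using b(2)[of k] that by (simp add: Z_def)
  qed
  then have \<phi>b: "\<phi> b = \<alpha>" using le[OF b(1)] by simp
  define Y where "Y = {i \<in> Z. \<phi> i = \<alpha>}"
  have "b \<in> Y" using b(1) \<phi>b by (simp add: Y_def)
  then have "Y \<noteq> {}" by blast
  then obtain j where j: "j \<in> Y" and first: "\<And>k. k \<in> Y \<Longrightarrow> R k j \<Longrightarrow> R j k"
    using final_element[of Y "\<lambda>a b. R b a"] R_refl R_trans by metis
  have jZ: "j \<in> Z" and \<phi>j: "\<phi> j = \<alpha>" using j by (simp_all add: Y_def)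
  have strict: "\<phi> i < \<phi> j" if "R i j" "\<not> R j i" for i
    using le[OF Z[OF that(1) jZ]] first[of i] that Z[OF that(1) jZ] \<phi>j by (auto simp: Y_def less_le)
  have "spectral_node R \<theta> j"
  proof (cases "\<phi> j = 0")
    case True
    \<comment> \<open>Roots are nonnegative, so no class accesses that of j strictly.\<close>
    have "R j i" if "R i j" for i
      using strict[OF that] adapted_root_nonneg[OF M, of i] True by fastforce
    then show ?thesis by (simp add: spectral_node_def)
  next
    case False
    then have "0 < \<phi> j" using adapted_root_nonneg[OF M, of j] by simp
    then show ?thesis using dominant_class_spectral[OF M A R comm] strict by blast
  qed
  then show "\<alpha> \<in> \<phi> ` {j. spectral_node R \<theta> j}" using \<phi>j by blast
qed

end

section \<open>Max polynomials of commuting matrices\<close>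

lemma max_mult_sum_mat_left:
  assumes "finite K" "nonneg_mat N"
  shows "max_sum_mat f K \<otimes>\<^sub>m N = max_sum_mat (\<lambda>m. f m \<otimes>\<^sub>m N) K"
proof -
  have "(max_sum_mat f K \<otimes>\<^sub>m N) $ i $ j = max_sum_mat (\<lambda>m. f m \<otimes>\<^sub>m N) K $ i $ j" for i j
    using max_sum_swap[of UNIV K "\<lambda>k m. f m $ i $ k * N $ k $ j"]
    by (simp add: max_mult_nth max_sum_mat_def max_sum_mult_right assms nonneg_matD)
  then show ?thesis by (simp add: vec_eq_iff)
qed

lemma max_mult_sum_mat_right:
  assumes "finite K" "nonneg_mat N"
  shows "N \<otimes>\<^sub>m max_sum_mat f K = max_sum_mat (\<lambda>m. N \<otimes>\<^sub>m f m) K"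
proof -
  have "(N \<otimes>\<^sub>m max_sum_mat f K) $ i $ j = max_sum_mat (\<lambda>m. N \<otimes>\<^sub>m f m) K $ i $ j" for i j
    using max_sum_swap[of UNIV K "\<lambda>k m. N $ i $ k * f m $ k $ j"]
    by (simp add: max_mult_nth max_sum_mat_def max_sum_mult_left assms nonneg_matD)
  then show ?thesis by (simp add: vec_eq_iff)
qed

lemma max_mult_one:
  assumes "nonneg_mat N"
  shows "mat 1 \<otimes>\<^sub>m N = N" "N \<otimes>\<^sub>m mat 1 = N"
proof -
  have "(mat 1 \<otimes>\<^sub>m N) $ i $ j = N $ i $ j" for i j
    unfolding max_mult_nth
    by (rule max_sum_eqI[of UNIV _ _ i]) (auto simp: mat_def nonneg_matD assms)
  moreover have "(N \<otimes>\<^sub>m mat 1) $ i $ j = N $ i $ j" for i j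
    unfolding max_mult_nth
    by (rule max_sum_eqI[of UNIV _ _ j]) (auto simp: mat_def nonneg_matD assms)
  ultimately show "mat 1 \<otimes>\<^sub>m N = N" "N \<otimes>\<^sub>m mat 1 = N" by (simp_all add: vec_eq_iff)
qed

lemma max_mult_commute_mult:
  assumes "nonneg_mat M" "nonneg_mat P" "nonneg_mat N"
    and "M \<otimes>\<^sub>m N = N \<otimes>\<^sub>m M" "P \<otimes>\<^sub>m N = N \<otimes>\<^sub>m P"
  shows "(M \<otimes>\<^sub>m P) \<otimes>\<^sub>m N = N \<otimes>\<^sub>m (M \<otimes>\<^sub>m P)"
proof -
  have "(M \<otimes>\<^sub>m P) \<otimes>\<^sub>m N = M \<otimes>\<^sub>m (N \<otimes>\<^sub>m P)"
    by (simp only: max_mult_assoc[OF assms(1,3)] assms(5))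
  also have "\<dots> = (N \<otimes>\<^sub>m M) \<otimes>\<^sub>m P"
    by (simp only: max_mult_assoc[OF assms(1,2), symmetric] assms(4))
  finally show ?thesis by (simp only: max_mult_assoc[OF assms(3,2)])
qed

lemma max_mult_scaleR:
  assumes "0 \<le> c"
  shows "(c *\<^sub>R M) \<otimes>\<^sub>m N = c *\<^sub>R (M \<otimes>\<^sub>m N)" "M \<otimes>\<^sub>m (c *\<^sub>R N) = c *\<^sub>R (M \<otimes>\<^sub>m N)"
proof -
  have "((c *\<^sub>R M) \<otimes>\<^sub>m N) $ i $ j = (c *\<^sub>R (M \<otimes>\<^sub>m N)) $ i $ j" for i j
    by (simp add: max_mult_nth max_sum_mult_left[OF _ assms] mult.assoc)
  moreover have "(M \<otimes>\<^sub>m (c *\<^sub>R N)) $ i $ j = (c *\<^sub>R (M \<otimes>\<^sub>m N)) $ i $ j" for i j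
    by (simp add: max_mult_nth max_sum_mult_left[OF _ assms] mult.left_commute)
  ultimately show "(c *\<^sub>R M) \<otimes>\<^sub>m N = c *\<^sub>R (M \<otimes>\<^sub>m N)" "M \<otimes>\<^sub>m (c *\<^sub>R N) = c *\<^sub>R (M \<otimes>\<^sub>m N)"
    unfolding vec_eq_iff by blast+
qed

context scaled_preorder
begin

lemma adapted_one: "adapted R x (mat 1) (\<lambda>_. 1)"
proof (rule adaptedI)
  show "nonneg_mat (mat 1)" by (simp add: nonneg_mat_def mat_def)
  show "R i j" if "0 < (mat 1 :: real^'n^'n) $ i $ j" for i j
    using that R_refl by (simp add: mat_def split: if_splits)
  show "mat 1 $ i $ k * x $ k \<le> 1 * x $ i" for i k
    using x_pos[of i] by (simp add: mat_def)
  show "\<exists>k. R i k \<and> R k i \<and> 1 * x $ i \<le> mat 1 $ i $ k * x $ k" for i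
    using R_refl by (intro exI[of _ i]) (simp add: mat_def)
qed simp

lemma adapted_mult:
  assumes M: "adapted R x M \<phi>" and N: "adapted R x N \<psi>"
  shows "adapted R x (M \<otimes>\<^sub>m N) (\<lambda>i. \<phi> i * \<psi> i)"
proof (rule adaptedI)
  have Mnn: "nonneg_mat M" and Nnn: "nonneg_mat N" using adaptedD(1) M N by blast+
  show "nonneg_mat (M \<otimes>\<^sub>m N)" by (rule nonneg_max_mult)
  have edge: "R i k \<and> R k j" if "M $ i $ k * N $ k $ j \<noteq> 0" for i k j
  proof -
    have "0 < M $ i $ k" "0 < N $ k $ j"
      using that nonneg_matD[OF Mnn, of i k] nonneg_matD[OF Nnn, of k j] by (auto simp: less_le)
    then show ?thesis using adaptedD(2) M N by blast
  qed
  show "R i j" if "0 < (M \<otimes>\<^sub>m N) $ i $ j" for i j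
  proof -
    have "0 < max_sum (\<lambda>k. M $ i $ k * N $ k $ j) UNIV" using that by (simp add: max_mult_nth)
    then obtain k where "max_sum (\<lambda>k. M $ i $ k * N $ k $ j) UNIV = M $ i $ k * N $ k $ j"
      by (elim max_sum_attained_pos[rotated]) auto
    then have "M $ i $ k * N $ k $ j \<noteq> 0" using that unfolding max_mult_nth by linarith
    then show ?thesis using edge R_trans by blast
  qed
  show "\<phi> i * \<psi> i = \<phi> j * \<psi> j" if "R i j" "R j i" for i j
    using adaptedD(3)[OF M that] adaptedD(3)[OF N that] by simp
  show "(M \<otimes>\<^sub>m N) $ i $ k * x $ k \<le> \<phi> i * \<psi> i * x $ i" if ik: "R i k" "R k i" for i k
  proof -
    have nn: "0 \<le> \<phi> i * \<psi> i * x $ i"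
      using adapted_root_nonneg[OF M] adapted_root_nonneg[OF N] x_pos[of i] by simp
    have "M $ i $ l * N $ l $ k * x $ k \<le> \<phi> i * \<psi> i * x $ i" for l
    proof (cases "M $ i $ l * N $ l $ k = 0")
      case True
      then show ?thesis using nn by (simp only: mult_zero_left)
    next
      case False
      then have "R i l" "R l k" using edge by blast+
      then have il: "R i l" "R l i" and lk: "R l k" "R k l" using ik R_trans by blast+
      have "M $ i $ l * (N $ l $ k * x $ k) \<le> M $ i $ l * (\<psi> l * x $ l)"
        using adaptedD(4)[OF N lk] nonneg_matD[OF Mnn] by (intro mult_left_mono)
      also have "\<dots> = \<psi> i * (M $ i $ l * x $ l)" using adaptedD(3)[OF N il] by simp
      also have "\<dots> \<le> \<psi> i * (\<phi> i * x $ i)"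
        using adaptedD(4)[OF M il] adapted_root_nonneg[OF N] by (intro mult_left_mono)
      finally show ?thesis by (simp add: mult_ac)
    qed
    then show ?thesis using nn x_pos[of k]
      by (simp add: max_mult_nth max_sum_mult_right max_sum_le_iff)
  qed
  show "\<exists>k. R i k \<and> R k i \<and> \<phi> i * \<psi> i * x $ i \<le> (M \<otimes>\<^sub>m N) $ i $ k * x $ k" for i
  proof -
    obtain l where l: "R i l" "R l i" "M $ i $ l * x $ l = \<phi> i * x $ i"
      using adapted_attained[OF M] .
    obtain k where k: "R l k" "R k l" "N $ l $ k * x $ k = \<psi> l * x $ l"
      using adapted_attained[OF N] .
    have "\<phi> i * \<psi> i * x $ i = M $ i $ l * (\<psi> l * x $ l)"
      using l(3) adaptedD(3)[OF N l(1,2)] by (simp add: mult_ac)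
    also have "\<dots> = M $ i $ l * N $ l $ k * x $ k" by (simp only: k(3)[symmetric] mult.assoc)
    also have "\<dots> \<le> (M \<otimes>\<^sub>m N) $ i $ k * x $ k"
      unfolding max_mult_nth using x_pos[of k]
      by (intro mult_right_mono max_sum_upper[of UNIV l "\<lambda>l. M $ i $ l * N $ l $ k"]) auto
    finally show ?thesis using l k R_trans by blast
  qed
qed

lemma adapted_scaleR:
  assumes M: "adapted R x M \<phi>" and c: "0 \<le> c"
  shows "adapted R x (c *\<^sub>R M) (\<lambda>i. c * \<phi> i)"
proof (rule adaptedI)
  show "nonneg_mat (c *\<^sub>R M)" using adaptedD(1)[OF M] c by (simp add: nonneg_mat_def)
  show "R i j" if "0 < (c *\<^sub>R M) $ i $ j" for i j
    using that c adaptedD(2)[OF M, of i j] by (simp add: zero_less_mult_iff)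
  show "c * \<phi> i = c * \<phi> j" if "R i j" "R j i" for i j using adaptedD(3)[OF M that] by simp
  show "(c *\<^sub>R M) $ i $ k * x $ k \<le> c * \<phi> i * x $ i" if "R i k" "R k i" for i k
    using mult_left_mono[OF adaptedD(4)[OF M that] c] by (simp add: mult.assoc)
  show "\<exists>k. R i k \<and> R k i \<and> c * \<phi> i * x $ i \<le> (c *\<^sub>R M) $ i $ k * x $ k" for i
  proof -
    obtain k where "R i k" "R k i" "M $ i $ k * x $ k = \<phi> i * x $ i" using adapted_attained[OF M] .
    then show ?thesis by (intro exI[of _ k]) (simp add: mult.assoc)
  qed
qed

lemma adapted_max_sum_mat:
  assumes "finite K" and M: "\<And>m. m \<in> K \<Longrightarrow> adapted R x (f m) (\<phi> m)"
  shows "adapted R x (max_sum_mat f K) (\<lambda>i. max_sum (\<lambda>m. \<phi> m i) K)"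
proof (rule adaptedI)
  have nth: "max_sum_mat f K $ i $ j = max_sum (\<lambda>m. f m $ i $ j) K" for i j
    by (simp add: max_sum_mat_def)
  show "nonneg_mat (max_sum_mat f K)" using assms(1) by (simp add: nonneg_mat_def nth max_sum_nonneg)
  show "R i j" if pos: "0 < max_sum_mat f K $ i $ j" for i j
  proof -
    obtain m where "m \<in> K" "max_sum (\<lambda>m. f m $ i $ j) K = f m $ i $ j"
      using max_sum_attained_pos[OF assms(1) pos[unfolded nth]] .
    then show ?thesis using pos adaptedD(2)[OF M] by (simp add: nth)
  qed
  show "max_sum (\<lambda>m. \<phi> m i) K = max_sum (\<lambda>m. \<phi> m j) K" if "R i j" "R j i" for i j
    using adaptedD(3)[OF M that] by (rule max_sum_cong)
  show "max_sum_mat f K $ i $ k * x $ k \<le> max_sum (\<lambda>m. \<phi> m i) K * x $ i"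
    if "R i k" "R k i" for i k
    using adaptedD(4)[OF M that] x_pos
    by (simp add: nth max_sum_mult_right assms(1) less_imp_le max_sum_mono)
  show "\<exists>k. R i k \<and> R k i \<and> max_sum (\<lambda>m. \<phi> m i) K * x $ i \<le> max_sum_mat f K $ i $ k * x $ k"
    if pos: "0 < max_sum (\<lambda>m. \<phi> m i) K" for i
  proof -
    obtain m where m: "m \<in> K" "max_sum (\<lambda>m. \<phi> m i) K = \<phi> m i"
      using max_sum_attained_pos[OF assms(1) pos] .
    obtain k where k: "R i k" "R k i" "f m $ i $ k * x $ k = \<phi> m i * x $ i"
      using adapted_attained[OF M[OF m(1)]] .
    have "f m $ i $ k * x $ k \<le> max_sum_mat f K $ i $ k * x $ k"
      unfolding nth using x_pos[of k]
      by (intro mult_right_mono max_sum_upper[OF assms(1) m(1), of "\<lambda>m. f m $ i $ k"]) auto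
    then show ?thesis using k m(2) by auto
  qed
qed

text \<open>
  Matrices that are adapted and commute with a given adapted matrix are closed under all
  operations from which a max polynomial is built, and their roots on the classes are then
  combined by the same operations.
\<close>

lemma adapted_commuting_power:
  assumes M: "adapted R x M \<phi>" "M \<otimes>\<^sub>m N = N \<otimes>\<^sub>m M" and N: "nonneg_mat N"
  shows "adapted R x (max_power M k) (\<lambda>i. \<phi> i ^ k) \<and> max_power M k \<otimes>\<^sub>m N = N \<otimes>\<^sub>m max_power M k"
proof (induction k)
  case 0
  then show ?case using adapted_one N by (simp add: max_mult_one)
next
  case (Suc k)
  have ad: "adapted R x (max_power M k) (\<lambda>i. \<phi> i ^ k)"
    and cm: "max_power M k \<otimes>\<^sub>m N = N \<otimes>\<^sub>m max_power M k" using Suc by auto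
  have "M \<otimes>\<^sub>m max_power M k \<otimes>\<^sub>m N = N \<otimes>\<^sub>m (M \<otimes>\<^sub>m max_power M k)"
    by (rule max_mult_commute_mult[OF adaptedD(1)[OF M(1)] adaptedD(1)[OF ad] N M(2) cm])
  then show ?case using adapted_mult[OF M(1) ad] by simp
qed

lemma adapted_commuting_monomial:
  assumes A: "\<And>i. i \<in> {1..r} \<Longrightarrow> adapted R x (A i) (\<theta> i)"
    and comm: "\<And>i. i \<in> {1..r} \<Longrightarrow> A i \<otimes>\<^sub>m N = N \<otimes>\<^sub>m A i" and N: "nonneg_mat N"
  shows "adapted R x (max_monomial_mat r m A)
      (\<lambda>j. \<Prod>i = 1..r. \<theta> i j ^ Poly_Mapping.lookup m i) \<and>
    max_monomial_mat r m A \<otimes>\<^sub>m N = N \<otimes>\<^sub>m max_monomial_mat r m A"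
proof -
  let ?F = "\<lambda>is. foldr (\<lambda>i B. max_power (A i) (Poly_Mapping.lookup m i) \<otimes>\<^sub>m B) is (mat 1)"
  have "adapted R x (?F is) (\<lambda>j. \<Prod>i\<leftarrow>is. \<theta> i j ^ Poly_Mapping.lookup m i) \<and>
      ?F is \<otimes>\<^sub>m N = N \<otimes>\<^sub>m ?F is" if "set is \<subseteq> {1..r}" for "is"
    using that
  proof (induction "is")
    case Nil
    then show ?case using adapted_one N by (simp add: max_mult_one)
  next
    case (Cons i "is")
    let ?P = "max_power (A i) (Poly_Mapping.lookup m i)"
    have i: "i \<in> {1..r}" using Cons.prems by simp
    have P: "adapted R x ?P (\<lambda>j. \<theta> i j ^ Poly_Mapping.lookup m i)" "?P \<otimes>\<^sub>m N = N \<otimes>\<^sub>m ?P"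
      using adapted_commuting_power[OF A[OF i] comm[OF i] N] by auto
    have F: "adapted R x (?F is) (\<lambda>j. \<Prod>i\<leftarrow>is. \<theta> i j ^ Poly_Mapping.lookup m i)"
      "?F is \<otimes>\<^sub>m N = N \<otimes>\<^sub>m ?F is"
      using Cons by auto
    have "?P \<otimes>\<^sub>m ?F is \<otimes>\<^sub>m N = N \<otimes>\<^sub>m (?P \<otimes>\<^sub>m ?F is)"
      by (rule max_mult_commute_mult[OF adaptedD(1)[OF P(1)] adaptedD(1)[OF F(1)] N P(2) F(2)])
    then show ?case using adapted_mult[OF P(1) F(1)] by simp
  qed
  moreover have set: "set [1..<Suc r] = {1..r}" by auto
  ultimately have "adapted R x (?F [1..<Suc r])
      (\<lambda>j. \<Prod>i\<leftarrow>[1..<Suc r]. \<theta> i j ^ Poly_Mapping.lookup m i) \<and>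
      ?F [1..<Suc r] \<otimes>\<^sub>m N = N \<otimes>\<^sub>m ?F [1..<Suc r]" by blast
  moreover have "(\<Prod>i\<leftarrow>[1..<Suc r]. f i) = (\<Prod>i = 1..r. f i)" for f :: "nat \<Rightarrow> real"
    using prod.distinct_set_conv_list[of "[1..<Suc r]" f] unfolding set by simp
  ultimately show ?thesis by (simp only: max_monomial_mat_def)
qed

lemma adapted_commuting_poly:
  assumes A: "\<And>i. i \<in> {1..r} \<Longrightarrow> adapted R x (A i) (\<theta> i)"
    and comm: "\<And>i. i \<in> {1..r} \<Longrightarrow> A i \<otimes>\<^sub>m N = N \<otimes>\<^sub>m A i" and N: "nonneg_mat N"
    and p: "is_max_poly r p"
  shows "adapted R x (max_poly_mat r p A) (\<lambda>j. max_poly_eval r p (\<lambda>i. \<theta> i j))"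
    and "max_poly_mat r p A \<otimes>\<^sub>m N = N \<otimes>\<^sub>m max_poly_mat r p A"
proof -
  have c: "0 \<le> Poly_Mapping.lookup p m" for m using p by (simp add: is_max_poly_def)
  have mono: "adapted R x (max_monomial_mat r m A) (\<lambda>j. \<Prod>i = 1..r. \<theta> i j ^ Poly_Mapping.lookup m i)"
    "max_monomial_mat r m A \<otimes>\<^sub>m N = N \<otimes>\<^sub>m max_monomial_mat r m A" for m
    using adapted_commuting_monomial[where A = A and \<theta> = \<theta> and r = r and m = m, OF A comm N]
    by blast+
  show "adapted R x (max_poly_mat r p A) (\<lambda>j. max_poly_eval r p (\<lambda>i. \<theta> i j))"
    unfolding max_poly_mat_def max_poly_eval_def
    by (intro adapted_max_sum_mat adapted_scaleR mono(1) c) simp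
  show "max_poly_mat r p A \<otimes>\<^sub>m N = N \<otimes>\<^sub>m max_poly_mat r p A"
    unfolding max_poly_mat_def
    by (simp add: max_mult_sum_mat_left max_mult_sum_mat_right N max_mult_scaleR c mono(2))
qed

end

section \<open>Commuting matrices with distinct Perron roots\<close>

theorem theorem4p8:
  fixes A :: "nat \<Rightarrow> real^'n^'n" and r :: nat
  assumes "1 \<le> r"
    and "\<forall>i \<in> {1..r}. nonneg_mat (A i)"
    and "\<forall>i \<in> {1..r}. \<forall>j \<in> {1..r}. A i \<otimes>\<^sub>m A j = A j \<otimes>\<^sub>m A i"
    and "\<forall>i \<in> {1..r}. inj_on (perron_root (A i)) (classes (A i))"
  shows
    "(\<forall>i \<in> {1..r}. classes (A i) = classes (max_sum_mat A {1..r})) \<and>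
     (\<forall>i \<in> {1..r}. transitive_closure_reduced_digraph (A i) =
        transitive_closure_reduced_digraph (max_sum_mat A {1..r})) \<and>
     ((\<forall>i \<in> {1..r}. spectral_classes (A i) = spectral_classes (max_sum_mat A {1..r})) \<and>
      (\<forall>i \<in> {1..r}. finite (max_eigenvalues (A i))) \<and>
      (\<forall>i \<in> {1..r}. \<forall>j \<in> {1..r}.
         card (max_eigenvalues (A i)) = card (max_eigenvalues (A j)))) \<and>
     (\<forall>S. (\<forall>i \<in> {1..r}. spectral_classes (A i) = S) \<longrightarrow>
        (\<forall>p. is_max_poly r p \<longrightarrow>
           max_eigenvalues (max_poly_mat r p A) =
             (\<lambda>\<mu>. max_poly_eval r p (\<lambda>i. perron_root (A i) \<mu>)) ` S))"
proof -
  define I where "I = {1..r}"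
  have one: "1 \<in> I" using assms(1) by (simp add: I_def)
  have fin: "finite I" and ne: "I \<noteq> {}" using one by (auto simp: I_def)
  have nn: "nonneg_mat (A l)" if "l \<in> I" for l using assms(2) that by (simp add: I_def)
  have comm: "A l \<otimes>\<^sub>m A m = A m \<otimes>\<^sub>m A l" if "l \<in> I" "m \<in> I" for l m
    using assms(3) that by (simp add: I_def)
  have inj: "inj_on (perron_root (A l)) (classes (A l))" if "l \<in> I" for l
    using assms(4) that by (simp add: I_def)
  define R where "R = reach (A 1)"
  have R: "reach (A l) = R" if l: "l \<in> I" for l
    using commuting_reach[OF nn[OF l] nn[OF one] comm[OF l one] inj[OF l]]
      commuting_reach[OF nn[OF one] nn[OF l] comm[OF one l] inj[OF one]]
    unfolding R_def by (intro ext) blast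
  obtain x where x: "\<forall>i. 0 < x $ i"
      "\<forall>l\<in>I. adapted R x (A l) (\<lambda>i. perron_root (A l) (cls R i))"
    using commuting_adapted[where A = A, OF fin nn comm R ne] by blast
  interpret scaled_preorder R x
  proof
    show "R i i" for i by (simp add: R_def reach_refl)
    show "R i k" if "R i j" "R j k" for i j k using that unfolding R_def by (rule reach_trans)
    show "0 < x $ i" for i using x(1) by simp
  qed
  define \<theta> where "\<theta> l i = perron_root (A l) (cls R i)" for l i
  have ad: "adapted R x (A l) (\<theta> l)" if "l \<in> I" for l
    using x(2) that unfolding \<theta>_def by blast
  have classes_A: "classes (A l) = range (cls R)" if "l \<in> I" for l
    using R[OF that] by (simp add: classes_eq)
  have distinct: "R i k" if "l \<in> I" "\<theta> l i = \<theta> l k" for l i k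
  proof -
    have "cls R i \<in> classes (A l)" "cls R k \<in> classes (A l)" using classes_A[OF that(1)] by simp_all
    with inj[OF that(1)] that(2)[unfolded \<theta>_def] have "cls R i = cls R k" by (rule inj_onD)
    then show ?thesis unfolding R_def by (simp add: cls_eq_iff)
  qed
  define Sp where "Sp = {j. spectral_node R (\<theta> 1) j}"
  have Sp: "{j. spectral_node R (\<theta> l) j} = Sp" if l: "l \<in> I" for l
    unfolding Sp_def
    using spectral_node_transfer[OF ad[OF l] distinct[OF l] ad[OF one] R[OF one, symmetric] comm[OF l one]]
      spectral_node_transfer[OF ad[OF one] distinct[OF one] ad[OF l] R[OF l, symmetric] comm[OF one l]]
    by blast
  have spectral_A: "spectral_classes (A l) = cls R ` Sp" if l: "l \<in> I" for l
    unfolding spectral_classes_eq R[OF l] Sp[OF l, symmetric] \<theta>_def ..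

  define B where "B = max_sum_mat A I"
  define \<beta> where "\<beta> i = max_sum (\<lambda>l. \<theta> l i) I" for i
  have adB: "adapted R x B \<beta>"
    unfolding B_def \<beta>_def by (rule adapted_max_sum_mat[where f = A and \<phi> = \<theta>, OF fin ad])
  have RB: "reach B = R"
  proof (intro ext iffI)
    fix i j
    show "R i j" if "reach B i j"
      by (rule reach_least[OF that]) (auto intro: R_refl R_trans adaptedD(2)[OF adB])
    have edge: "reach B a b" if "0 < A 1 $ a $ b" for a b
    proof -
      have "A 1 $ a $ b \<le> B $ a $ b"
        using max_sum_upper[OF fin one, of "\<lambda>l. A l $ a $ b"] by (simp add: B_def max_sum_mat_def)
      then show ?thesis using that by (intro reach_edge) linarith
    qed
    show "reach B i j" if "R i j"
      by (rule reach_least[OF that[unfolded R_def]]) (fact reach_refl reach_trans edge)+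
  qed
  have \<beta>_root: "perron_root B (cls R i) = \<beta> i" for i
    by (rule adapted_perron_root[OF adB x_pos R_refl R_trans])
  \<comment> \<open>A noninitial class that is spectral for the sum is spectral for a matrix attaining its root.\<close>
  have "spectral_node R \<beta> j \<longleftrightarrow> j \<in> Sp" for j
  proof (cases "\<forall>i. R i j \<longrightarrow> R j i")
    case True
    then show ?thesis by (simp add: Sp_def spectral_node_def)
  next
    case non_initial: False
    show ?thesis
    proof
      assume "spectral_node R \<beta> j"
      then have pos: "0 < \<beta> j" and dom: "\<And>i. R i j \<Longrightarrow> \<beta> i \<le> \<beta> j"
        using non_initial unfolding spectral_node_def by blast+
      obtain l where l: "l \<in> I" "\<beta> j = \<theta> l j"
        using max_sum_attained_pos[OF fin pos[unfolded \<beta>_def]] unfolding \<beta>_def .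
      have "\<theta> l i \<le> \<theta> l j" if "R i j" for i
        using max_sum_upper[OF fin l(1), of "\<lambda>l. \<theta> l i"] dom[OF that] l(2) by (simp add: \<beta>_def)
      then have "spectral_node R (\<theta> l) j" using pos l(2) by (simp add: spectral_node_def)
      then show "j \<in> Sp" using Sp[OF l(1)] by blast
    next
      assume "j \<in> Sp"
      then have l: "0 < \<theta> l j \<and> (\<forall>i. R i j \<longrightarrow> \<theta> l i \<le> \<theta> l j)" if "l \<in> I" for l
        using Sp[OF that] non_initial unfolding spectral_node_def by blast
      have "\<beta> i \<le> \<beta> j" if "R i j" for i
        unfolding \<beta>_def using l that by (intro max_sum_mono[OF fin]) blast
      moreover have "0 < \<beta> j"
        using l[OF one] max_sum_upper[OF fin one, of "\<lambda>l. \<theta> l j"] by (simp add: \<beta>_def)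
      ultimately show "spectral_node R \<beta> j" by (simp add: spectral_node_def)
    qed
  qed
  then have "{j. spectral_node R \<beta> j} = Sp" by blast
  then have spectral_B: "spectral_classes B = cls R ` Sp"
    unfolding spectral_classes_eq RB \<beta>_root by (rule arg_cong)

  have eigenvalues: "max_eigenvalues M = \<phi> ` Sp"
    if "adapted R x M \<phi>" "M \<otimes>\<^sub>m A 1 = A 1 \<otimes>\<^sub>m M" for M \<phi>
    unfolding Sp_def
    by (rule eigenvalues_eq_spectral_roots[OF that(1) ad[OF one] R_def distinct[OF one] that(2)])
  have eig_A: "max_eigenvalues (A l) = perron_root (A l) ` cls R ` Sp" if l: "l \<in> I" for l
    using eigenvalues[OF ad[OF l] comm[OF l one]] by (simp add: image_image \<theta>_def)
  have card_eig: "card (max_eigenvalues (A l)) = card (cls R ` Sp)" if l: "l \<in> I" for l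
    unfolding eig_A[OF l]
    by (rule card_image) (rule inj_on_subset[OF inj[OF l]], use classes_A[OF l] in auto)
  have poly: "max_eigenvalues (max_poly_mat r p A) =
      (\<lambda>\<mu>. max_poly_eval r p (\<lambda>i. perron_root (A i) \<mu>)) ` cls R ` Sp"
    if p: "is_max_poly r p" for p
  proof -
    have "max_eigenvalues (max_poly_mat r p A) = (\<lambda>j. max_poly_eval r p (\<lambda>i. \<theta> i j)) ` Sp"
    proof (rule eigenvalues)
      note closed = adapted_commuting_poly[where A = A and N = "A 1" and r = r and \<theta> = \<theta> and p = p,
          folded I_def, OF ad comm[OF _ one] nn[OF one] p]
      show "adapted R x (max_poly_mat r p A) (\<lambda>j. max_poly_eval r p (\<lambda>i. \<theta> i j))"
        by (rule closed(1))
      show "max_poly_mat r p A \<otimes>\<^sub>m A 1 = A 1 \<otimes>\<^sub>m max_poly_mat r p A" by (rule closed(2))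
    qed
    then show ?thesis by (simp add: image_image \<theta>_def)
  qed

  have "classes (A l) = classes B" if "l \<in> I" for l
    using R[OF that] RB by (simp add: classes_eq)
  moreover have "transitive_closure_reduced_digraph (A l) = transitive_closure_reduced_digraph B"
    if "l \<in> I" for l by (rule transitive_closure_eqI) (simp add: R[OF that] RB)
  moreover have "finite (max_eigenvalues (A l))" if "l \<in> I" for l
    by (simp add: eig_A[OF that])
  moreover have "max_eigenvalues (max_poly_mat r p A) =
      (\<lambda>\<mu>. max_poly_eval r p (\<lambda>i. perron_root (A i) \<mu>)) ` S"
    if "\<forall>i\<in>I. spectral_classes (A i) = S" "is_max_poly r p" for S p
  proof -
    have "S = cls R ` Sp" using that(1) spectral_A[OF one] one by blast
    then show ?thesis using poly[OF that(2)] by simp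
  qed
  ultimately show ?thesis
    unfolding I_def[symmetric] B_def[symmetric] using spectral_A spectral_B card_eig by simp
qed

end
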